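(* Let $p\ge 1$ and consider the two-dimensional linear advection-diffusion equation $\partial_t u+\nabla\cdot(\boldsymbol\alpha u-\beta\boldsymbol q)=0$, $\boldsymbol q=\nabla u$, with constant $\boldsymbol\alpha\in\mathbb R^2$ and constant $\beta\ge 0$, with periodic boundary conditions, discretized on a conforming Cartesian quadrilateral grid by the tensor-product hybridized flux reconstruction method of degree $p$ with VCJH correction functions of parameter $c$ (the method is defined in the context; the trace space is either the discontinuous space $M^h_p$ or the continuous space $\bar M^h_p$). Suppose that (i) on every face, on each of its two sides $\pm$, the stabilization parameter $s_\pm=s_\pm^{(c)}+s_\pm^{(v)}$ satisfies $s_\pm>\dfrac{\boldsymbol\alpha\cdot\boldsymbol n_\pm}{2}$, where $\boldsymbol n_\pm$ is the unit normal outward from the element on side $\pm$; and (ii) $c\ge 0$. Then the numerical solution $u^h$ satisfies $$\frac12\frac{d}{dt}\Vert u^h\Vert_{p,2}^2\le 0,$$ where the broken Sobolev norm is $$\Vert u^h\Vert_{p,2}^2=\sum_{k=1}^N\int_{\Omega_k}\left[(u^h_k)^2+\frac c2\left(\left(\frac{\partial^p u^h_k}{\partial\xi^p}\right)^2+\left(\frac{\partial^p u^h_k}{\partial\eta^p}\right)^2\right)+\frac{c^2}{4}\left(\frac{\partial^{2p}u^h_k}{\partial\xi^p\partial\eta^p}\right)^2\right]d\Omega_k .$$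
   Context: **Grid.** The periodic rectangular domain is partitioned into $N$ conforming axis-aligned rectangles $\Omega_k$. Each is the image of the reference square $\tilde\Omega=[-1,1]^2$, with coordinates $(\xi,\eta)$, under an affine map with constant Jacobian matrix $\boldsymbol J_k=\operatorname{diag}(J_x,J_y)$, $J_x,J_y>0$, and determinant $J_k=J_xJ_y$. $\tilde\nabla$ is the gradient/divergence in $(\xi,\eta)$. Each element has four faces $f$. The unit outward normals are $\boldsymbol n_{k,f}$ (physical) and $\tilde{\boldsymbol n}_f$ (reference). The face Jacobian is $J_x$ on horizontal faces and $J_y$ on vertical faces. $\varepsilon^h$ is the set of distinct faces $\bar f$ of the grid, with periodic faces identified, so every $\bar f$ is shared by two elements (sides $-$ and $+$, with $\boldsymbol n_-=-\boldsymbol n_+$). **Spaces.** $u^h_k(\cdot,t)$ is, in reference coordinates, a polynomial of degree at most $p$ in each of $\xi,\eta$. No continuity is required between elements. The trace variable $\hat u^h(\cdot,t)$ lies in $M^h_p=\{\mu\in L_2(\varepsilon^h):\mu|_{\bar f}\in\mathbb P^p(\bar f)\ \forall\bar f\in\varepsilon^h\}$ (HFR) or in $\bar M^h_p=M^h_p\cap C^0(\varepsilon^h)$ (EFR). $\hat u^h_{\bar f}$ is its restriction to $\bar f$. All unknowns are differentiable in time. **VCJH correction functions.** In one dimension, with $L_j$ the Legendre polynomial of degree $j$, $a_p$ the leading coefficient of $L_p$, and $\eta_p=\frac{c(2p+1)(a_pp!)^2}{2}$, $$g_L=\tfrac{(-1)^p}{2}\Big[L_p-\tfrac{\eta_pL_{p-1}+L_{p+1}}{1+\eta_p}\Big],\qquad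 g_R=\tfrac12\Big[L_p+\tfrac{\eta_pL_{p-1}+L_{p+1}}{1+\eta_p}\Big].$$ Let $\{\ell_m\}_{m=1}^{p+1}$ be the Lagrange basis of degree $p$ at the $p+1$ flux points of a face. The tensor-product vector correction function $\boldsymbol g_f^m$ of the $m$-th flux point of face $f$ is $g_R(\xi)\ell_m(\eta)\boldsymbol e_\xi$ on the face $\xi=1$ and $-g_L(\xi)\ell_m(\eta)\boldsymbol e_\xi$ on the face $\xi=-1$, and analogously with $\xi,\eta$ exchanged on $\eta=\pm1$. Thus $\tilde{\boldsymbol n}_f\cdot\boldsymbol g_l^n=\delta_{fl}\delta_{mn}$ at the $m$-th flux point of face $f$. **Method.** The gradient variable $\boldsymbol q^h_k=\boldsymbol J_k^{-T}\tilde{\boldsymbol q}^h_k$ is given by $$\tilde{\boldsymbol q}^h_k=\tilde\nabla u^h_k+\sum_f\sum_m\tilde{\boldsymbol n}_f\,(\tilde\nabla\cdot\boldsymbol g_f^m)\,[\hat u^h_{\bar f}-u^h_{k,f}]_{\text{flux point }m},$$ where $u^h_{k,f}$ (and likewise $\boldsymbol q^h_{k,f}$) is the element polynomial restricted to $f$. The common (Riemann) flux is $$\hat{\boldsymbol{\mathfrak F}}_{k,f}=\boldsymbol\alpha\hat u^h_{\bar f}-\beta\boldsymbol q^h_{k,f}+s_{k,f}(u^h_{k,f}-\hat u^h_{\bar f})\boldsymbol n_{k,f},\qquad s_{k,f}=s^{(c)}_{k,f}+s^{(v)}_{k,f}\in\mathbb R,$$ where $s_{k,f}$ is a constant for each element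 side of a face. With $\boldsymbol F_k=\boldsymbol\alpha u^h_k-\beta\boldsymbol q^h_k$, $\tilde{\boldsymbol F}_k=J_k\boldsymbol J_k^{-1}\boldsymbol F_k$, and $\tilde H_{k,f}=J_{k,f}\hat{\boldsymbol{\mathfrak F}}_{k,f}\cdot\boldsymbol n_{k,f}-\tilde{\boldsymbol F}_{k,f}\cdot\tilde{\boldsymbol n}_f$ ($J_{k,f}$ the face Jacobian), the solution evolves by $$\frac{\partial u^h_k}{\partial t}+\frac1{J_k}\tilde\nabla\cdot\tilde{\boldsymbol F}_k+\frac1{J_k}\sum_f\sum_m(\tilde\nabla\cdot\boldsymbol g_f^m)\,[\tilde H_{k,f}]_{\text{flux point }m}=0 .$$ **Transmission (conservativity) conditions.** $\llbracket\hat{\boldsymbol{\mathfrak F}}\rrbracket_{\bar f}:=\hat{\boldsymbol{\mathfrak F}}_{-}\cdot\boldsymbol n_-+\hat{\boldsymbol{\mathfrak F}}_{+}\cdot\boldsymbol n_+=0$ on every face $\bar f\in\varepsilon^h$. Its discrete form is $\sum_{\bar f\in\varepsilon^h}\int_{\bar f}\llbracket\hat{\boldsymbol{\mathfrak F}}\rrbracket_{\bar f}\,\mu\,ds=0$ for all $\mu$ in the chosen trace space.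
   Formalization: For the continuous trace space with c > 0, the transmission condition is assumed pointwise (the flux jump vanishes on every face), not only tested against continuous traces; under the tested form alone the inequality can fail, e.g. for p = 1, α = 0, β = 0, s = 1 on a 3×3 grid. *)

theory Defs
  imports "HOL-Analysis.Analysis" "HOL-Computational_Algebra.Polynomial"
begin

section \<open>Periodic conforming Cartesian grids\<close>

record grid =
  num_elems :: nat
  dom_lo :: "real \<times> real"
  dom_hi :: "real \<times> real"
  el_lo :: "nat \<Rightarrow> real \<times> real"
  el_hi :: "nat \<Rightarrow> real \<times> real"

text \<open>The faces of the reference square: \<open>West\<close>, \<open>East\<close> are \<open>\<xi> = -1\<close>, \<open>\<xi> = 1\<close>;
  \<open>South\<close>, \<open>North\<close> are \<open>\<eta> = -1\<close>, \<open>\<eta> = 1\<close>.\<close>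

datatype side = West | East | South | North

lemma UNIV_side: "(UNIV :: side set) = {West, East, South, North}"
  using side.exhaust by auto

instance side :: finite
  by standard (simp add: UNIV_side)

text \<open>The elements are axis-aligned, so the physical outward unit normal of a face and the
  reference one are the same vector.\<close>

fun normal :: "side \<Rightarrow> real \<times> real" where
  "normal West = (-1, 0)"
| "normal East = (1, 0)"
| "normal South = (0, -1)"
| "normal North = (0, 1)"

text \<open>A face is parametrised by its tangential reference coordinate \<open>s \<in> [-1, 1]\<close>.\<close>

fun ref_pt :: "side \<Rightarrow> real \<Rightarrow> real \<times> real" where
  "ref_pt West s = (-1, s)"
| "ref_pt East s = (1, s)"
| "ref_pt South s = (s, -1)"
| "ref_pt North s = (s, 1)"

definition Jx :: "grid \<Rightarrow> nat \<Rightarrow> real" where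
  "Jx G k = (fst (el_hi G k) - fst (el_lo G k)) / 2"

definition Jy :: "grid \<Rightarrow> nat \<Rightarrow> real" where
  "Jy G k = (snd (el_hi G k) - snd (el_lo G k)) / 2"

definition Jdet :: "grid \<Rightarrow> nat \<Rightarrow> real" where
  "Jdet G k = Jx G k * Jy G k"

fun Jface :: "grid \<Rightarrow> nat \<times> side \<Rightarrow> real" where
  "Jface G (k, West) = Jy G k"
| "Jface G (k, East) = Jy G k"
| "Jface G (k, South) = Jx G k"
| "Jface G (k, North) = Jx G k"

definition to_phys :: "grid \<Rightarrow> nat \<Rightarrow> real \<times> real \<Rightarrow> real \<times> real" where
  "to_phys G k z = ((fst (el_lo G k) + fst (el_hi G k)) / 2 + Jx G k * fst z,
                    (snd (el_lo G k) + snd (el_hi G k)) / 2 + Jy G k * snd z)"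

definition to_ref :: "grid \<Rightarrow> nat \<Rightarrow> real \<times> real \<Rightarrow> real \<times> real" where
  "to_ref G k x = ((fst x - (fst (el_lo G k) + fst (el_hi G k)) / 2) / Jx G k,
                   (snd x - (snd (el_lo G k) + snd (el_hi G k)) / 2) / Jy G k)"

definition side_pt :: "grid \<Rightarrow> nat \<times> side \<Rightarrow> real \<Rightarrow> real \<times> real" where
  "side_pt G \<sigma> s = to_phys G (fst \<sigma>) (ref_pt (snd \<sigma>) s)"

definition period :: "grid \<Rightarrow> int \<Rightarrow> int \<Rightarrow> real \<times> real" where
  "period G m n = (of_int m * (fst (dom_hi G) - fst (dom_lo G)),
                   of_int n * (snd (dom_hi G) - snd (dom_lo G)))"

definition sides :: "grid \<Rightarrow> (nat \<times> side) set" where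
  "sides G = {..<num_elems G} \<times> UNIV"

text \<open>Two element sides are the same face of the periodic grid when they are the same segment
  up to a period. All sides are parametrised in increasing coordinate direction, so the
  parametrisations then agree as well.\<close>

definition same_face :: "grid \<Rightarrow> nat \<times> side \<Rightarrow> nat \<times> side \<Rightarrow> bool" where
  "same_face G \<sigma> \<tau> \<longleftrightarrow>
     (\<exists>m n. \<forall>s\<in>{-1..1}. side_pt G \<sigma> s = side_pt G \<tau> s + period G m n)"

text \<open>A face of the grid is represented by the set of the element sides that form it.\<close>

definition the_face :: "grid \<Rightarrow> nat \<times> side \<Rightarrow> (nat \<times> side) set" where
  "the_face G \<sigma> = {\<tau> \<in> sides G. same_face G \<sigma> \<tau>}"

definition faces :: "grid \<Rightarrow> (nat \<times> side) set set" where
  "faces G = the_face G ` sides G"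

definition conforming :: "grid \<Rightarrow> bool" where
  "conforming G \<longleftrightarrow>
     (\<forall>\<sigma>\<in>sides G. \<exists>\<tau>\<in>sides G. \<tau> \<noteq> \<sigma> \<and> the_face G \<sigma> = {\<sigma>, \<tau>} \<and>
        normal (snd \<tau>) = - normal (snd \<sigma>))"

definition cartesian_grid :: "grid \<Rightarrow> bool" where
  "cartesian_grid G \<longleftrightarrow>
     fst (dom_lo G) < fst (dom_hi G) \<and> snd (dom_lo G) < snd (dom_hi G) \<and>
     (\<forall>k<num_elems G. fst (el_lo G k) < fst (el_hi G k) \<and> snd (el_lo G k) < snd (el_hi G k)) \<and>
     (\<Union>k<num_elems G. cbox (el_lo G k) (el_hi G k)) = cbox (dom_lo G) (dom_hi G) \<and>
     (\<forall>k<num_elems G. \<forall>l<num_elems G. k \<noteq> l \<longrightarrow>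
        box (el_lo G k) (el_hi G k) \<inter> box (el_lo G l) (el_hi G l) = {}) \<and>
     conforming G"

section \<open>Differential operators in the reference coordinates\<close>

definition d_xi :: "(real \<times> real \<Rightarrow> real) \<Rightarrow> real \<times> real \<Rightarrow> real" where
  "d_xi v z = deriv (\<lambda>x. v (x, snd z)) (fst z)"

definition d_eta :: "(real \<times> real \<Rightarrow> real) \<Rightarrow> real \<times> real \<Rightarrow> real" where
  "d_eta v z = deriv (\<lambda>y. v (fst z, y)) (snd z)"

definition grad :: "(real \<times> real \<Rightarrow> real) \<Rightarrow> real \<times> real \<Rightarrow> real \<times> real" where
  "grad v z = (d_xi v z, d_eta v z)"

definition divg :: "(real \<times> real \<Rightarrow> real \<times> real) \<Rightarrow> real \<times> real \<Rightarrow> real" where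
  "divg w z = d_xi (\<lambda>y. fst (w y)) z + d_eta (\<lambda>y. snd (w y)) z"

section \<open>Discrete spaces\<close>

definition Q_space :: "nat \<Rightarrow> (real \<times> real \<Rightarrow> real) set" where
  "Q_space p = {v. \<exists>a. v = (\<lambda>z. \<Sum>i\<le>p. \<Sum>j\<le>p. a i j * fst z ^ i * snd z ^ j)}"

definition P_space :: "nat \<Rightarrow> (real \<Rightarrow> real) set" where
  "P_space p = {v. \<exists>q. degree q \<le> p \<and> v = poly q}"

text \<open>A trace function is a family of functions, one per face of the grid, of the tangential
  reference coordinate; being polynomial of degree at most \<open>p\<close> in it is the same as being so
  in arc length.\<close>

type_synonym trace = "(nat \<times> side) set \<Rightarrow> real \<Rightarrow> real"

definition M_space :: "grid \<Rightarrow> nat \<Rightarrow> trace set" where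
  "M_space G p = {\<mu>. \<forall>f\<in>faces G. \<mu> f \<in> P_space p}"

definition skeleton :: "grid \<Rightarrow> (real \<times> real) set" where
  "skeleton G = (\<Union>\<sigma>\<in>sides G. side_pt G \<sigma> ` {-1..1})"

text \<open>Continuity on the skeleton of the periodic grid.\<close>

definition C0_skeleton :: "grid \<Rightarrow> trace set" where
  "C0_skeleton G = {\<mu>. \<exists>g :: real \<times> real \<Rightarrow> real.
     continuous_on (skeleton G) g \<and>
     (\<forall>x\<in>skeleton G. \<forall>y\<in>skeleton G. \<forall>m n. x = y + period G m n \<longrightarrow> g x = g y) \<and>
     (\<forall>\<sigma>\<in>sides G. \<forall>s\<in>{-1..1}. \<mu> (the_face G \<sigma>) s = g (side_pt G \<sigma> s))}"

datatype trace_kind = HFR | EFR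

fun trace_space :: "grid \<Rightarrow> nat \<Rightarrow> trace_kind \<Rightarrow> trace set" where
  "trace_space G p HFR = M_space G p"
| "trace_space G p EFR = M_space G p \<inter> C0_skeleton G"

section \<open>VCJH correction functions\<close>

text \<open>Legendre polynomials by the formula of Rodrigues.\<close>

definition legendre :: "nat \<Rightarrow> real poly" where
  "legendre n = smult (1 / (2 ^ n * fact n)) ((pderiv ^^ n) ([:-1, 0, 1:] ^ n))"

definition vcjh_eta :: "nat \<Rightarrow> real \<Rightarrow> real" where
  "vcjh_eta p c = c * (2 * real p + 1) * (lead_coeff (legendre p) * fact p)\<^sup>2 / 2"

text \<open>Only used for \<open>p \<ge> 1\<close>.\<close>

definition gL :: "nat \<Rightarrow> real \<Rightarrow> real poly" where
  "gL p c = smult ((-1) ^ p / 2) (legendre p -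
     smult (1 / (1 + vcjh_eta p c)) (smult (vcjh_eta p c) (legendre (p - 1)) + legendre (p + 1)))"

definition gR :: "nat \<Rightarrow> real \<Rightarrow> real poly" where
  "gR p c = smult (1 / 2) (legendre p +
     smult (1 / (1 + vcjh_eta p c)) (smult (vcjh_eta p c) (legendre (p - 1)) + legendre (p + 1)))"

text \<open>\<open>X f m\<close> is the tangential reference coordinate of the \<open>m\<close>-th flux point
  (\<open>1 \<le> m \<le> p + 1\<close>) of the reference face \<open>f\<close>.\<close>

definition flux_points :: "nat \<Rightarrow> (side \<Rightarrow> nat \<Rightarrow> real) \<Rightarrow> bool" where
  "flux_points p X \<longleftrightarrow>
     (\<forall>f. inj_on (X f) {1..p + 1} \<and> X f ` {1..p + 1} \<subseteq> {-1..1})"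

definition lagrange :: "nat \<Rightarrow> (nat \<Rightarrow> real) \<Rightarrow> nat \<Rightarrow> real \<Rightarrow> real" where
  "lagrange p x m s = (\<Prod>j\<in>{1..p + 1} - {m}. (s - x j) / (x m - x j))"

fun corr :: "nat \<Rightarrow> real \<Rightarrow> (side \<Rightarrow> nat \<Rightarrow> real) \<Rightarrow> side \<Rightarrow> nat \<Rightarrow> real \<times> real \<Rightarrow> real \<times> real" where
  "corr p c X East m (\<xi>, \<eta>) = (poly (gR p c) \<xi> * lagrange p (X East) m \<eta>, 0)"
| "corr p c X West m (\<xi>, \<eta>) = (- poly (gL p c) \<xi> * lagrange p (X West) m \<eta>, 0)"
| "corr p c X North m (\<xi>, \<eta>) = (0, poly (gR p c) \<eta> * lagrange p (X North) m \<xi>)"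
| "corr p c X South m (\<xi>, \<eta>) = (0, - poly (gL p c) \<eta> * lagrange p (X South) m \<xi>)"

section \<open>The hybridized flux reconstruction method\<close>

text \<open>Up to the transmission conditions, \<open>u\<close> and \<open>uh\<close> are the element solutions and the trace variable at a fixed
  time; \<open>u k\<close> is a function of the reference coordinates of element \<open>k\<close>.\<close>

definition q_ref :: "grid \<Rightarrow> nat \<Rightarrow> real \<Rightarrow> (side \<Rightarrow> nat \<Rightarrow> real) \<Rightarrow>
    (nat \<Rightarrow> real \<times> real \<Rightarrow> real) \<Rightarrow> trace \<Rightarrow> nat \<Rightarrow> real \<times> real \<Rightarrow> real \<times> real" where
  "q_ref G p c X u uh k z = grad (u k) z +
     (\<Sum>f\<in>UNIV. \<Sum>m\<in>{1..p + 1}.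
        (divg (corr p c X f m) z * (uh (the_face G (k, f)) (X f m) - u k (ref_pt f (X f m))))
          *\<^sub>R normal f)"

definition q_phys :: "grid \<Rightarrow> nat \<Rightarrow> real \<Rightarrow> (side \<Rightarrow> nat \<Rightarrow> real) \<Rightarrow>
    (nat \<Rightarrow> real \<times> real \<Rightarrow> real) \<Rightarrow> trace \<Rightarrow> nat \<Rightarrow> real \<times> real \<Rightarrow> real \<times> real" where
  "q_phys G p c X u uh k z =
     (fst (q_ref G p c X u uh k z) / Jx G k, snd (q_ref G p c X u uh k z) / Jy G k)"

definition flux :: "grid \<Rightarrow> nat \<Rightarrow> real \<Rightarrow> real \<times> real \<Rightarrow> real \<Rightarrow> (side \<Rightarrow> nat \<Rightarrow> real) \<Rightarrow>
    (nat \<Rightarrow> real \<times> real \<Rightarrow> real) \<Rightarrow> trace \<Rightarrow> nat \<Rightarrow> real \<times> real \<Rightarrow> real \<times> real" where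
  "flux G p c \<alpha> \<beta> X u uh k z = u k z *\<^sub>R \<alpha> - \<beta> *\<^sub>R q_phys G p c X u uh k z"

text \<open>The contravariant flux: the determinant times the inverse of the Jacobian matrix
  \<open>diag (Jx, Jy)\<close>, applied to the flux.\<close>

definition flux_ref :: "grid \<Rightarrow> nat \<Rightarrow> real \<Rightarrow> real \<times> real \<Rightarrow> real \<Rightarrow> (side \<Rightarrow> nat \<Rightarrow> real) \<Rightarrow>
    (nat \<Rightarrow> real \<times> real \<Rightarrow> real) \<Rightarrow> trace \<Rightarrow> nat \<Rightarrow> real \<times> real \<Rightarrow> real \<times> real" where
  "flux_ref G p c \<alpha> \<beta> X u uh k z =
     Jdet G k *\<^sub>R (fst (flux G p c \<alpha> \<beta> X u uh k z) / Jx G k,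
                 snd (flux G p c \<alpha> \<beta> X u uh k z) / Jy G k)"

definition common_flux :: "grid \<Rightarrow> nat \<Rightarrow> real \<Rightarrow> real \<times> real \<Rightarrow> real \<Rightarrow> (side \<Rightarrow> nat \<Rightarrow> real) \<Rightarrow>
    (nat \<times> side \<Rightarrow> real) \<Rightarrow> (nat \<Rightarrow> real \<times> real \<Rightarrow> real) \<Rightarrow> trace \<Rightarrow>
    nat \<times> side \<Rightarrow> real \<Rightarrow> real \<times> real" where
  "common_flux G p c \<alpha> \<beta> X stab u uh \<sigma> s = (case \<sigma> of (k, f) \<Rightarrow>
     uh (the_face G (k, f)) s *\<^sub>R \<alpha> - \<beta> *\<^sub>R q_phys G p c X u uh k (ref_pt f s)
       + (stab (k, f) * (u k (ref_pt f s) - uh (the_face G (k, f)) s)) *\<^sub>R normal f)"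

definition flux_defect :: "grid \<Rightarrow> nat \<Rightarrow> real \<Rightarrow> real \<times> real \<Rightarrow> real \<Rightarrow> (side \<Rightarrow> nat \<Rightarrow> real) \<Rightarrow>
    (nat \<times> side \<Rightarrow> real) \<Rightarrow> (nat \<Rightarrow> real \<times> real \<Rightarrow> real) \<Rightarrow> trace \<Rightarrow>
    nat \<times> side \<Rightarrow> real \<Rightarrow> real" where
  "flux_defect G p c \<alpha> \<beta> X stab u uh \<sigma> s = (case \<sigma> of (k, f) \<Rightarrow>
     Jface G (k, f) * (common_flux G p c \<alpha> \<beta> X stab u uh (k, f) s \<bullet> normal f)
       - flux_ref G p c \<alpha> \<beta> X u uh k (ref_pt f s) \<bullet> normal f)"

definition flux_jump :: "grid \<Rightarrow> nat \<Rightarrow> real \<Rightarrow> real \<times> real \<Rightarrow> real \<Rightarrow> (side \<Rightarrow> nat \<Rightarrow> real) \<Rightarrow>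
    (nat \<times> side \<Rightarrow> real) \<Rightarrow> (nat \<Rightarrow> real \<times> real \<Rightarrow> real) \<Rightarrow> trace \<Rightarrow>
    (nat \<times> side) set \<Rightarrow> real \<Rightarrow> real" where
  "flux_jump G p c \<alpha> \<beta> X stab u uh F s =
     (\<Sum>\<sigma>\<in>F. common_flux G p c \<alpha> \<beta> X stab u uh \<sigma> s \<bullet> normal (snd \<sigma>))"

text \<open>Integral over a face with respect to arc length; both sides of a face have the same
  face Jacobian.\<close>

definition face_integral :: "grid \<Rightarrow> (nat \<times> side) set \<Rightarrow> (real \<Rightarrow> real) \<Rightarrow> real" where
  "face_integral G F \<phi> = (THE J. \<forall>\<sigma>\<in>F. Jface G \<sigma> = J) * integral {-1..1} \<phi>"

text \<open>The conservativity conditions, pointwise and in discrete form. For the discontinuous trace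
  space the two are equivalent, because the jump is itself a member of that space. For the
  continuous one the discrete form is strictly weaker.\<close>

definition pointwise_transmission :: "grid \<Rightarrow> nat \<Rightarrow> real \<Rightarrow> real \<times> real \<Rightarrow> real \<Rightarrow>
    (side \<Rightarrow> nat \<Rightarrow> real) \<Rightarrow> (nat \<times> side \<Rightarrow> real) \<Rightarrow> (nat \<Rightarrow> real \<times> real \<Rightarrow> real) \<Rightarrow> trace \<Rightarrow> bool" where
  "pointwise_transmission G p c \<alpha> \<beta> X stab u uh \<longleftrightarrow>
     (\<forall>F\<in>faces G. \<forall>s\<in>{-1..1}. flux_jump G p c \<alpha> \<beta> X stab u uh F s = 0)"

definition discrete_transmission :: "grid \<Rightarrow> nat \<Rightarrow> real \<Rightarrow> real \<times> real \<Rightarrow> real \<Rightarrow>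
    (side \<Rightarrow> nat \<Rightarrow> real) \<Rightarrow> (nat \<times> side \<Rightarrow> real) \<Rightarrow> trace_kind \<Rightarrow>
    (nat \<Rightarrow> real \<times> real \<Rightarrow> real) \<Rightarrow> trace \<Rightarrow> bool" where
  "discrete_transmission G p c \<alpha> \<beta> X stab kind u uh \<longleftrightarrow>
     (\<forall>\<mu>\<in>trace_space G p kind.
        (\<Sum>F\<in>faces G. face_integral G F
           (\<lambda>s. flux_jump G p c \<alpha> \<beta> X stab u uh F s * \<mu> F s)) = 0)"

text \<open>Here \<open>u t\<close>, \<open>uh t\<close> are the element solutions and the trace variable at time \<open>t \<in> I\<close>.\<close>

definition hfr_solution :: "grid \<Rightarrow> nat \<Rightarrow> real \<Rightarrow> real \<times> real \<Rightarrow> real \<Rightarrow>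
    (side \<Rightarrow> nat \<Rightarrow> real) \<Rightarrow> (nat \<times> side \<Rightarrow> real) \<Rightarrow> trace_kind \<Rightarrow> real set \<Rightarrow>
    (real \<Rightarrow> nat \<Rightarrow> real \<times> real \<Rightarrow> real) \<Rightarrow> (real \<Rightarrow> trace) \<Rightarrow> bool" where
  "hfr_solution G p c \<alpha> \<beta> X stab kind I u uh \<longleftrightarrow>
     (\<forall>t\<in>I.
        (\<forall>k<num_elems G. u t k \<in> Q_space p) \<and>
        uh t \<in> trace_space G p kind \<and>
        (\<forall>k<num_elems G. \<forall>z\<in>cbox (-1, -1) (1, 1). (\<lambda>\<tau>. u \<tau> k z) differentiable (at t)) \<and>
        (\<forall>F\<in>faces G. \<forall>s\<in>{-1..1}. (\<lambda>\<tau>. uh \<tau> F s) differentiable (at t)) \<and>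
        (\<forall>k<num_elems G. \<forall>z\<in>cbox (-1, -1) (1, 1).
           deriv (\<lambda>\<tau>. u \<tau> k z) t
           + 1 / Jdet G k * divg (flux_ref G p c \<alpha> \<beta> X (u t) (uh t) k) z
           + 1 / Jdet G k * (\<Sum>f\<in>UNIV. \<Sum>m\<in>{1..p + 1}. divg (corr p c X f m) z *
               flux_defect G p c \<alpha> \<beta> X stab (u t) (uh t) (k, f) (X f m)) = 0) \<and>
        discrete_transmission G p c \<alpha> \<beta> X stab kind (u t) (uh t))"

section \<open>The broken Sobolev norm\<close>

text \<open>The derivatives are taken in the reference coordinates, the integral over the physical
  element.\<close>

definition broken_norm_sq :: "grid \<Rightarrow> nat \<Rightarrow> real \<Rightarrow> (nat \<Rightarrow> real \<times> real \<Rightarrow> real) \<Rightarrow> real" where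
  "broken_norm_sq G p c u = (\<Sum>k<num_elems G.
     integral (cbox (el_lo G k) (el_hi G k)) (\<lambda>x. let z = to_ref G k x in
       (u k z)\<^sup>2 + c / 2 * (((d_xi ^^ p) (u k) z)\<^sup>2 + ((d_eta ^^ p) (u k) z)\<^sup>2)
       + c\<^sup>2 / 4 * ((d_xi ^^ p) ((d_eta ^^ p) (u k)) z)\<^sup>2))"

end

theory Submission
  imports Defs
begin

text \<open>The broken norm comes from the tensor product of the one-dimensional inner product
  \<open>\<integral> f g + c/2 D\<^sup>p f D\<^sup>p g\<close>, and the two facts that drive the proof are one-dimensional. First, the
  derivatives of the correction functions represent, up to sign, evaluation at the end points: this
  is what \<open>\<eta>\<^sub>p\<close> is made for. Secondly, integration by parts is exact on polynomials of degree at
  most \<open>p\<close>. In this inner product the method is therefore an ordinary discontinuous Galerkin method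
  with face terms in the one-dimensional inner product. Testing it with \<open>u\<close> and subtracting the
  transmission condition tested with the trace variable leaves on each element side a term
  \<open>(\<alpha> \<bullet> n / 2 - s) \<parallel>u - \<mu>\<parallel>\<^sup>2 \<le> 0\<close>, with \<open>\<mu>\<close> the trace variable, a term \<open>\<alpha> \<bullet> n / 2 \<parallel>\<mu>\<parallel>\<^sup>2\<close> that
  cancels between the two sides of the face, and the volume dissipation \<open>-\<beta> \<parallel>q\<parallel>\<^sup>2\<close>.\<close>

section \<open>Polynomials of one variable\<close>

text \<open>The obstacle is a mismatch of pairings: the discrete transmission condition is an L2
  statement on the faces, whereas the element balances pair the fluxes with the trace variable in
  the inner product that also contains p-th derivatives. For c = 0 the two agree. For c \<noteq> 0
  the jump has to vanish pointwise: in HFR it lies in the trace space and can be tested against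
  itself, in EFR this is the hypothesis \<open>transmission\<close>. The diffusive face terms cancel
  instead of being estimated: the equation for q, tested with q in the same Sobolev inner product,
  turns the pairing of q with the gradient of u into the square of q and face pairings of q with the
  difference of u and the trace variable; the flux -\<beta> q produces the same face pairings. The
  scheme and the differentiability in time are given only pointwise on the reference square.
  Interpolation at a tensor grid of nodes turns both into statements about polynomials, to which the
  inner products apply.\<close>

lemma deriv_poly_fun [simp]: "deriv (poly q) = poly (pderiv q)" for q :: "real poly"
  by (rule ext, rule DERIV_imp_deriv, rule poly_DERIV)

lemma higher_deriv_poly: "(deriv ^^ n) (poly q) = poly ((pderiv ^^ n) q)" for q :: "real poly"
  by (induction n) auto

lemma P_space_poly: "degree q \<le> p \<Longrightarrow> poly q \<in> P_space p"
  by (auto simp: P_space_def)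

lemma P_spaceE:
  assumes "f \<in> P_space p"
  obtains q where "degree q \<le> p" "f = poly q"
  using assms by (auto simp: P_space_def)

lemma P_space_add:
  assumes "f \<in> P_space p" "g \<in> P_space p"
  shows "(\<lambda>x. f x + g x) \<in> P_space p"
proof -
  obtain q r where q: "degree q \<le> p" "f = poly q" and r: "degree r \<le> p" "g = poly r"
    using assms by (meson P_spaceE)
  have "(\<lambda>x. f x + g x) = poly (q + r)" by (simp add: q r fun_eq_iff)
  then show ?thesis using P_space_poly degree_add_le q(1) r(1) by metis
qed

lemma P_space_scale:
  assumes "f \<in> P_space p"
  shows "(\<lambda>x. a * f x) \<in> P_space p"
proof -
  obtain q where q: "degree q \<le> p" "f = poly q" using assms by (meson P_spaceE)
  have "(\<lambda>x. a * f x) = poly (smult a q)" by (simp add: q fun_eq_iff)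
  then show ?thesis using P_space_poly degree_smult_le q(1) order_trans by metis
qed

lemma P_space_diff:
  assumes "f \<in> P_space p" "g \<in> P_space p"
  shows "(\<lambda>x. f x - g x) \<in> P_space p"
  using P_space_add[OF assms(1) P_space_scale[OF assms(2), of "-1"]] by simp

lemma P_space_zero: "(\<lambda>x. 0) \<in> P_space p"
proof -
  have "(\<lambda>x. 0) = poly (0 :: real poly)" by auto
  then show ?thesis using P_space_poly[of 0 p] by simp
qed

lemma P_space_sum:
  assumes "\<And>i. i \<in> S \<Longrightarrow> f i \<in> P_space p"
  shows "(\<lambda>x. \<Sum>i\<in>S. f i x) \<in> P_space p"
  using assms by (induction S rule: infinite_finite_induct) (auto simp: P_space_zero P_space_add)

lemma continuous_on_P_space:
  assumes "f \<in> P_space p"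
  shows "continuous_on S f"
  using assms by (auto elim!: P_spaceE intro: continuous_intros)

lemma higher_deriv_P_space:
  assumes "f \<in> P_space p"
  shows "(deriv ^^ n) f \<in> P_space p"
proof -
  have "degree ((pderiv ^^ n) q) \<le> degree q" for q :: "real poly"
    by (induction n) (auto simp: degree_pderiv intro: diff_le_self order_trans)
  then show ?thesis
    using assms by (metis P_spaceE P_space_poly higher_deriv_poly order_trans)
qed

lemma higher_deriv_add_P_space:
  assumes "f \<in> P_space p" "g \<in> P_space p"
  shows "(deriv ^^ n) (\<lambda>x. f x + g x) = (\<lambda>x. (deriv ^^ n) f x + (deriv ^^ n) g x)"
proof -
  obtain q r where q: "f = poly q" and r: "g = poly r" using assms by (meson P_spaceE)
  have "(pderiv ^^ n) (q + r) = (pderiv ^^ n) q + (pderiv ^^ n) r"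
    by (induction n) (auto simp: pderiv_add)
  moreover have "(\<lambda>x. f x + g x) = poly (q + r)" by (simp add: q r fun_eq_iff)
  ultimately show ?thesis by (simp only: q r higher_deriv_poly) auto
qed

lemma higher_deriv_scale_P_space:
  assumes "f \<in> P_space p"
  shows "(deriv ^^ n) (\<lambda>x. a * f x) = (\<lambda>x. a * (deriv ^^ n) f x)"
proof -
  obtain q where q: "f = poly q" using assms by (meson P_spaceE)
  have "(pderiv ^^ n) (smult a q) = smult a ((pderiv ^^ n) q)"
    by (induction n) (auto simp: pderiv_smult)
  moreover have "(\<lambda>x. a * f x) = poly (smult a q)" by (simp add: q fun_eq_iff)
  ultimately show ?thesis by (simp only: q higher_deriv_poly) auto
qed

lemma P_space_eqI:
  assumes "f \<in> P_space p" "g \<in> P_space p" "finite A" "card A = Suc p"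
    and "\<And>x. x \<in> A \<Longrightarrow> f x = g x"
  shows "f = g"
proof -
  obtain q r where q: "degree q \<le> p" "f = poly q" and r: "degree r \<le> p" "g = poly r"
    using assms by (meson P_spaceE)
  have "q = r"
    using assms q r by (intro poly_eqI_degree[of A]) auto
  then show ?thesis by (simp add: q r)
qed

text \<open>The flux jump is known to vanish only for parameters in [-1, 1]; the interval contains p
  + 1 points, so the whole function is zero.\<close>

lemma P_space_zeroI:
  assumes "f \<in> P_space p" "\<And>x. x \<in> {-1..1} \<Longrightarrow> f x = 0"
  shows "f = (\<lambda>x. 0)"
proof -
  have "infinite {-1..1::real}" by simp
  then obtain A where "A \<subseteq> {-1..1::real}" "finite A" "card A = Suc p"
    using infinite_arbitrarily_large by blast
  then show ?thesis using assms by (intro P_space_eqI[OF assms(1) P_space_zero]) auto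
qed

section \<open>Lagrange interpolation at the flux points\<close>

lemma lagrange_P_space:
  assumes "m \<in> {1..p + 1}"
  shows "lagrange p x m \<in> P_space p"
proof -
  define q where "q = (\<Prod>j\<in>{1..p + 1} - {m}. smult (1 / (x m - x j)) [:- x j, 1:])"
  have "degree q \<le> (\<Sum>j\<in>{1..p + 1} - {m}. degree (smult (1 / (x m - x j)) [:- x j, 1:]))"
    unfolding q_def by (rule order_trans[OF degree_prod_sum_le]) auto
  also have "\<dots> \<le> (\<Sum>j\<in>{1..p + 1} - {m}. 1)"
    by (intro sum_mono) (simp add: degree_smult_le)
  also have "\<dots> = p" using assms by simp
  finally have "degree q \<le> p" .
  moreover have "lagrange p x m = poly q"
    by (simp add: fun_eq_iff lagrange_def q_def poly_prod diff_divide_distrib algebra_simps)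
  ultimately show ?thesis using P_space_poly by metis
qed

text \<open>Both sides have degree at most p and agree at p + 1 distinct nodes.\<close>

lemma lagrange_interpolation:
  assumes "f \<in> P_space p" "inj_on x {1..p + 1}"
  shows "f s = (\<Sum>m\<in>{1..p + 1}. f (x m) * lagrange p x m s)"
proof -
  have "f = (\<lambda>s. \<Sum>m\<in>{1..p + 1}. f (x m) * lagrange p x m s)"
  proof (rule P_space_eqI[OF assms(1), where A = "x ` {1..p + 1}"])
    show "(\<lambda>s. \<Sum>m\<in>{1..p + 1}. f (x m) * lagrange p x m s) \<in> P_space p"
      by (intro P_space_sum P_space_scale lagrange_P_space)
    show "card (x ` {1..p + 1}) = Suc p" using card_image[OF assms(2)] by simp
  next
    fix s assume "s \<in> x ` {1..p + 1}"
    then obtain n where n: "n \<in> {1..p + 1}" "s = x n" by blast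
    have "lagrange p x m s = (if m = n then 1 else 0)" if "m \<in> {1..p + 1}" for m
    proof (cases "m = n")
      case True
      have "x n \<noteq> x j" if "j \<in> {1..p + 1} - {n}" for j
        using that n assms(2) by (auto dest: inj_onD)
      then show ?thesis unfolding lagrange_def n True by (auto intro!: prod.neutral)
    next
      case False
      then show ?thesis using n unfolding lagrange_def by (auto intro!: prod_zero)
    qed
    then have "(\<Sum>m\<in>{1..p + 1}. f (x m) * lagrange p x m s)
        = (\<Sum>m\<in>{1..p + 1}. if m = n then f (x m) else 0)"
      by (intro sum.cong) auto
    also have "\<dots> = f s" using n by simp
    finally show "f s = (\<Sum>m\<in>{1..p + 1}. f (x m) * lagrange p x m s)" by simp
  qed auto
  then show ?thesis by metis
qed

section \<open>The one-dimensional VCJH inner product\<close>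

text \<open>Functions rather than polynomials are paired, because slices and traces of the element
  solution are functions. Linearity therefore carries membership in \<open>P_space\<close>, which
  guarantees derivatives and integrability.\<close>

definition vcjh_ip :: "nat \<Rightarrow> real \<Rightarrow> (real \<Rightarrow> real) \<Rightarrow> (real \<Rightarrow> real) \<Rightarrow> real" where
  "vcjh_ip p c f g =
     integral {-1..1} (\<lambda>x. f x * g x + c / 2 * ((deriv ^^ p) f x * (deriv ^^ p) g x))"

lemma continuous_on_vip_integrand:
  assumes "f \<in> P_space p" "g \<in> P_space p"
  shows "continuous_on S (\<lambda>x. f x * g x + c / 2 * ((deriv ^^ p) f x * (deriv ^^ p) g x))"
  by (intro continuous_intros continuous_on_P_space[of _ p] higher_deriv_P_space assms)

lemma vcjh_ip_commute: "vcjh_ip p c f g = vcjh_ip p c g f"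
  by (simp add: vcjh_ip_def mult.commute)

lemma vcjh_ip_add_left:
  assumes "f \<in> P_space p" "g \<in> P_space p" "h \<in> P_space p"
  shows "vcjh_ip p c (\<lambda>x. f x + g x) h = vcjh_ip p c f h + vcjh_ip p c g h"
proof -
  note int = integrable_continuous_real[OF continuous_on_vip_integrand]
  show ?thesis
    unfolding vcjh_ip_def higher_deriv_add_P_space[OF assms(1,2)]
      integral_add[OF int[OF assms(1,3)] int[OF assms(2,3)], symmetric]
    by (simp add: algebra_simps)
qed

lemma vcjh_ip_scale_left:
  assumes "f \<in> P_space p"
  shows "vcjh_ip p c (\<lambda>x. a * f x) h = a * vcjh_ip p c f h"
  unfolding vcjh_ip_def higher_deriv_scale_P_space[OF assms]
  by (subst integral_mult_right[symmetric]) (simp add: algebra_simps)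

lemma vcjh_ip_add_right:
  assumes "f \<in> P_space p" "g \<in> P_space p" "h \<in> P_space p"
  shows "vcjh_ip p c h (\<lambda>x. f x + g x) = vcjh_ip p c h f + vcjh_ip p c h g"
  using vcjh_ip_add_left[OF assms] by (simp add: vcjh_ip_commute)

lemma vcjh_ip_scale_right:
  assumes "f \<in> P_space p"
  shows "vcjh_ip p c h (\<lambda>x. a * f x) = a * vcjh_ip p c h f"
  using vcjh_ip_scale_left[OF assms] by (simp add: vcjh_ip_commute)

lemma vcjh_ip_diff_left:
  assumes "f \<in> P_space p" "g \<in> P_space p" "h \<in> P_space p"
  shows "vcjh_ip p c (\<lambda>x. f x - g x) h = vcjh_ip p c f h - vcjh_ip p c g h"
  using vcjh_ip_add_left[OF assms(1) P_space_scale[OF assms(2), of "-1"] assms(3)]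
    vcjh_ip_scale_left[OF assms(2), of c "-1"] by simp

lemma vcjh_ip_diff_right:
  assumes "f \<in> P_space p" "g \<in> P_space p" "h \<in> P_space p"
  shows "vcjh_ip p c h (\<lambda>x. f x - g x) = vcjh_ip p c h f - vcjh_ip p c h g"
  using vcjh_ip_diff_left[OF assms] by (simp add: vcjh_ip_commute)

lemma vcjh_ip_zero_left: "vcjh_ip p c (\<lambda>x. 0) g = 0"
  using vcjh_ip_scale_left[OF P_space_zero, of p c 0] by simp

lemma vcjh_ip_nonneg:
  assumes "f \<in> P_space p" "c \<ge> 0"
  shows "vcjh_ip p c f f \<ge> 0"
  unfolding vcjh_ip_def using assms
  by (intro integral_nonneg integrable_continuous_real continuous_on_vip_integrand) auto

text \<open>Integration as a linear functional on \<open>real poly\<close> keeps the computations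
  below algebraic, free of integrability conditions.\<close>

definition poly_int :: "real poly \<Rightarrow> real" where
  "poly_int q = integral {-1..1} (poly q)"

lemma poly_int_pderiv:
  "poly_int (pderiv q) = poly q 1 - poly q (-1)" for q :: "real poly"
proof -
  have "(poly (pderiv q) has_integral (poly q 1 - poly q (-1))) {-1..1}"
    by (rule fundamental_theorem_of_calculus)
      (auto simp flip: has_real_derivative_iff_has_vector_derivative
        intro: DERIV_subset[OF poly_DERIV])
  then show ?thesis unfolding poly_int_def by (rule integral_unique)
qed

lemma integrable_poly: "poly q integrable_on {-1..1}" for q :: "real poly"
  by (intro integrable_continuous_real continuous_intros)

lemma poly_int_add:
  "poly_int (q + r) = poly_int q + poly_int r"
  for q r :: "real poly"
proof -
  have "poly (q + r) = (\<lambda>x. poly q x + poly r x)" by auto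
  then show ?thesis using integral_add[OF integrable_poly integrable_poly] by (simp add: poly_int_def)
qed

lemma poly_int_smult:
  "poly_int (smult a q) = a * poly_int q" for q :: "real poly"
proof -
  have "poly (smult a q) = (\<lambda>x. a * poly q x)" by auto
  then show ?thesis by (simp add: poly_int_def)
qed

lemma poly_int_by_parts:
  "poly_int (pderiv q * r)
     = poly (q * r) 1 - poly (q * r) (-1) - poly_int (q * pderiv r)"
  for q r :: "real poly"
  using poly_int_pderiv[of "q * r"]
  by (simp add: pderiv_mult poly_int_add mult.commute)

lemma vcjh_ip_poly:
  "vcjh_ip p c (poly q) (poly r) = poly_int (q * r)
     + c / 2 * poly_int ((pderiv ^^ p) q * (pderiv ^^ p) r)"
proof -
  have "vcjh_ip p c (poly q) (poly r)
      = poly_int (q * r + smult (c / 2) ((pderiv ^^ p) q * (pderiv ^^ p) r))"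
    unfolding vcjh_ip_def higher_deriv_poly poly_int_def by (intro arg_cong[where f = "integral _"]) auto
  then show ?thesis by (simp only: poly_int_add poly_int_smult)
qed

lemma funpow_pderiv_eq_0:
  assumes "degree q < n"
  shows "(pderiv ^^ n) q = (0 :: real poly)"
  using assms
proof (induction n arbitrary: q)
  case (Suc n)
  show ?case
  proof (cases "n = 0")
    case True
    with Suc.prems show ?thesis by (simp add: pderiv_eq_0_iff)
  next
    case False
    with Suc.prems have "degree (pderiv q) < n" by (simp add: degree_pderiv)
    then show ?thesis using Suc.IH by (simp add: funpow_Suc_right del: funpow.simps)
  qed
qed simp

text \<open>Consequently the c-term of the inner product is a product of leading
  coefficients.\<close>

lemma funpow_pderiv_degree_le:
  fixes q :: "real poly"
  assumes "degree q \<le> n"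
  shows "(pderiv ^^ n) q = [:fact n * coeff q n:]"
  using assms
proof (induction n arbitrary: q)
  case 0
  then show ?case by (simp add: degree_eq_zeroE) (metis coeff_pCons_0 degree_eq_zeroE)
next
  case (Suc n)
  then have "(pderiv ^^ n) (pderiv q) = [:fact n * coeff (pderiv q) n:]"
    by (intro Suc.IH) (simp add: degree_pderiv)
  then show ?case
    by (simp add: funpow_Suc_right coeff_pderiv algebra_simps del: funpow.simps)
qed

text \<open>One derivative brings the degree below p, so the p-th derivative of a derivative
  vanishes. The c-term drops out of both pairings and ordinary integration by parts remains.\<close>

lemma vcjh_ip_by_parts:
  assumes "degree q \<le> p" "degree r \<le> p"
  shows "vcjh_ip p c (poly (pderiv q)) (poly r) + vcjh_ip p c (poly q) (poly (pderiv r))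
     = poly q 1 * poly r 1 - poly q (-1) * poly r (-1)"
proof -
  have "(pderiv ^^ p) (pderiv s) = 0" if "degree s \<le> p" for s :: "real poly"
    using funpow_pderiv_eq_0[of s "Suc p"] that by (simp add: funpow_Suc_right del: funpow.simps)
  moreover have "poly_int (0 :: real poly) = 0"
    using poly_int_smult[of 0 0] by simp
  ultimately show ?thesis using assms poly_int_by_parts[of q r] by (simp add: vcjh_ip_poly)
qed

section \<open>Legendre polynomials and correction functions\<close>

text \<open>Each differentiation removes one factor of the n-fold zero at a and changes only the
  cofactor; hence r is arbitrary in the inductions. At a the new cofactor is n + 1 times the old
  one, which accumulates to the factorial.\<close>

lemma funpow_pderiv_power_mult:
  fixes r :: "real poly"
  shows "j < n \<Longrightarrow> poly ((pderiv ^^ j) ([:-a, 1:] ^ n * r)) a = 0"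
    and "poly ((pderiv ^^ n) ([:-a, 1:] ^ n * r)) a = fact n * poly r a"
proof -
  have step: "(pderiv ^^ Suc j) ([:-a, 1:] ^ Suc n * r)
      = (pderiv ^^ j) ([:-a, 1:] ^ n * (smult (real n + 1) r + [:-a, 1:] * pderiv r))" for j n r
  proof -
    define l :: "real poly" where "l = [:-a, 1:]"
    have "pderiv l = 1" by (simp add: l_def pderiv_pCons)
    then have "pderiv (l ^ Suc n) = smult (real n + 1) (l ^ n)"
      by (simp only: pderiv_power_Suc) (simp add: add.commute)
    then have "pderiv (l ^ Suc n * r) = l ^ n * (smult (real n + 1) r + l * pderiv r)"
      by (simp only: pderiv_mult) (simp add: algebra_simps)
    then have "pderiv ([:-a, 1:] ^ Suc n * r)
        = [:-a, 1:] ^ n * (smult (real n + 1) r + [:-a, 1:] * pderiv r)"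
      by (simp only: l_def)
    then show ?thesis by (simp add: funpow_Suc_right del: funpow.simps power_Suc)
  qed
  show "j < n \<Longrightarrow> poly ((pderiv ^^ j) ([:-a, 1:] ^ n * r)) a = 0"
  proof (induction n arbitrary: j r)
    case (Suc n)
    then show ?case
      by (cases j) (simp_all only: step, simp_all)
  qed simp
  show "poly ((pderiv ^^ n) ([:-a, 1:] ^ n * r)) a = fact n * poly r a"
  proof (induction n arbitrary: r)
    case (Suc n)
    show ?case unfolding step Suc.IH by (simp add: algebra_simps)
  qed simp
qed

abbreviation x2m1 :: "real poly" where "x2m1 \<equiv> [:-1, 0, 1:]"

text \<open>Each factorisation puts the zero at one end point first. The form \<open>-(-1)\<close>
  is kept so that it matches \<open>[:-a, 1:]\<close> with a = -1.\<close>

lemma x2m1_power: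
  "x2m1 ^ n = [:-1, 1:] ^ n * [:1, 1:] ^ n" "x2m1 ^ n = [:-(-1), 1:] ^ n * [:-1, 1:] ^ n"
  by (simp_all flip: power_mult_distrib)

lemma funpow_pderiv_x2m1_boundary:
  assumes "j < n"
  shows "poly ((pderiv ^^ j) (x2m1 ^ n)) 1 = 0" "poly ((pderiv ^^ j) (x2m1 ^ n)) (-1) = 0"
  by (simp_all only: funpow_pderiv_power_mult(1)[OF assms, of 1 "[:1, 1:] ^ n", folded x2m1_power(1)]
    funpow_pderiv_power_mult(1)[OF assms, of "-1" "[:-1, 1:] ^ n", folded x2m1_power(2)])

text \<open>At an end point a = 1 or a = -1 the n-th derivative of \<open>x2m1 ^ n\<close> is n!
  times the n-th power of the other linear factor, whose value is 2a. The normalisation in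
  \<open>legendre\<close> leaves a^n.\<close>

lemma legendre_boundary:
  "poly (legendre n) 1 = 1" "poly (legendre n) (-1) = (-1) ^ n"
  using funpow_pderiv_power_mult(2)[of n 1 "[:1, 1:] ^ n", folded x2m1_power(1)]
    funpow_pderiv_power_mult(2)[of n "-1" "[:-1, 1:] ^ n", folded x2m1_power(2)]
  by (auto simp: legendre_def power_minus[of 2])

text \<open>All boundary terms vanish, since the derivatives of \<open>x2m1 ^ n\<close> that they
  contain have order below n. The case j = n moves every derivative onto q.\<close>

lemma integral_funpow_pderiv_by_parts:
  assumes "j \<le> n"
  shows "poly_int ((pderiv ^^ n) (x2m1 ^ n) * q)
    = (-1) ^ j * poly_int ((pderiv ^^ (n - j)) (x2m1 ^ n) * (pderiv ^^ j) q)"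
  using assms
proof (induction j)
  case (Suc j)
  then obtain i where i: "n = j + Suc i" using less_natE by (metis Suc_le_lessD add_Suc_right)
  then have "n - j = Suc i" "n - Suc j = i" "i < n" by auto
  then show ?case
    using Suc poly_int_by_parts[of "(pderiv ^^ i) (x2m1 ^ n)" "(pderiv ^^ j) q"]
      funpow_pderiv_x2m1_boundary[of i n] by simp
qed simp

lemma integral_x2m1_power:
  "poly_int (x2m1 ^ n) = (-1) ^ n * (2 ^ (2 * n + 1) * (fact n)\<^sup>2 / fact (2 * n + 1))"
proof (induction n)
  case 0
  show ?case using poly_int_pderiv[of "[:0, 1:]"] by (simp add: pderiv_pCons one_pCons)
next
  case (Suc n)
  \<comment> \<open>The polynomial x (x^2 - 1)^(n+1) vanishes at both end points, so the integral of
    its derivative is zero. Writing x^2 as (x^2 - 1) + 1 turns this into a recursion between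
    consecutive exponents.\<close>
  have "pderiv ([:0, 1:] * x2m1 ^ Suc n)
      = smult (2 * real n + 3) (x2m1 ^ Suc n) + smult (2 * (real n + 1)) (x2m1 ^ n)"
  proof (rule poly_eq_poly_eq_iff[THEN iffD1])
    show "poly (pderiv ([:0, 1:] * x2m1 ^ Suc n))
      = poly (smult (2 * real n + 3) (x2m1 ^ Suc n) + smult (2 * (real n + 1)) (x2m1 ^ n))"
      by (simp only: pderiv_mult pderiv_power_Suc)
        (auto simp: fun_eq_iff pderiv_pCons algebra_simps)
  qed
  then have "(2 * real n + 3) * poly_int (x2m1 ^ Suc n)
      + 2 * (real n + 1) * poly_int (x2m1 ^ n) = 0"
    using poly_int_pderiv[of "[:0, 1:] * x2m1 ^ Suc n"]
    by (simp only: poly_int_add poly_int_smult)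
      (simp del: power_Suc mult_pCons_left add: poly_power)
  then have "poly_int (x2m1 ^ Suc n)
      = - (2 * (real n + 1)) / (2 * real n + 3) * poly_int (x2m1 ^ n)"
    by (simp add: divide_simps) (simp add: algebra_simps)
  also have "\<dots> = (-1) ^ Suc n * (2 ^ (2 * Suc n + 1) * (fact (Suc n))\<^sup>2 / fact (2 * Suc n + 1))"
  proof -
    \<comment> \<open>With a = n + 1 and b = 2n + 3, the fraction is extended by 2a to supply the
      missing factor of (2n + 3)!. Letters replace factorials and powers so that they stay
      atomic.\<close>
    have *: "- (2 * a) / b * (S * (P * F\<^sup>2 / W)) = - S * (4 * P * (a * F)\<^sup>2 / (b * (2 * a) * W))"
      if "a \<noteq> 0" "b \<noteq> 0" "W \<noteq> 0" for a b S P F W :: real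
      using that by (simp add: field_simps power2_eq_square)
    have "fact (2 * Suc n + 1) = (2 * real n + 3) * (2 * (real n + 1)) * fact (2 * n + 1)"
      "fact (Suc n) = (real n + 1) * fact n"
      by (simp_all add: algebra_simps)
    moreover have "(2 :: real) ^ (2 * Suc n + 1) = 4 * 2 ^ (2 * n + 1)"
      "(-1 :: real) ^ Suc n = - ((-1) ^ n)" by simp_all
    ultimately show ?thesis unfolding Suc by (simp only:) (rule *, auto)
  qed
  finally show ?case .
qed

text \<open>By Rodrigues' formula all n derivatives fall on q and leave the constant n! times its
  n-th coefficient. One formula thus covers orthogonality to lower degrees, where the coefficient is
  0, and the pairing in degree n.\<close>

lemma integral_legendre_mult:
  assumes "degree q \<le> n"
  shows "poly_int (legendre n * q)
    = coeff q n * (2 ^ (n + 1) * (fact n)\<^sup>2 / fact (2 * n + 1))"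
proof -
  have "poly_int (legendre n * q)
      = 1 / (2 ^ n * fact n) * ((-1) ^ n * poly_int (x2m1 ^ n * [:fact n * coeff q n:]))"
    using integral_funpow_pderiv_by_parts[of n n q]
    by (simp add: legendre_def poly_int_smult funpow_pderiv_degree_le[OF assms] del: mult_pCons_right)
  also have "poly_int (x2m1 ^ n * [:fact n * coeff q n:])
      = fact n * coeff q n * poly_int (x2m1 ^ n)"
    by (simp add: poly_int_smult)
  also have "1 / (2 ^ n * fact n) * ((-1) ^ n * (fact n * coeff q n * poly_int (x2m1 ^ n)))
      = ((-1) ^ n * (-1) ^ n) * (coeff q n * (2 ^ (2 * n + 1) * (fact n)\<^sup>2 / fact (2 * n + 1) / 2 ^ n))"
  proof -
    have *: "1 / (P * F) * (S * (F * C * (S * K))) = (S * S) * (C * (K / P))"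
      if "F \<noteq> 0" for P F S C K :: real
      using that by simp
    show ?thesis unfolding integral_x2m1_power
      using *[of "fact n" "2 ^ n" "(-1) ^ n" "coeff q n" "2 ^ (2 * n + 1) * (fact n)\<^sup>2 / fact (2 * n + 1)"]
      by (simp only: fact_nonzero not_False_eq_True simp_thms)
  qed
  also have "\<dots> = coeff q n * (2 ^ (n + 1) * (fact n)\<^sup>2 / fact (2 * n + 1))"
  proof -
    have "(2 :: real) ^ (2 * n + 1) = 2 ^ (n + 1) * 2 ^ n" by (simp flip: power_add)
    then show ?thesis by (simp only: minus_one_mult_self) simp
  qed
  finally show ?thesis .
qed

lemma degree_legendre: "degree (legendre n) = n"
  and coeff_legendre: "coeff (legendre n) n = fact (2 * n) / (2 ^ n * (fact n)\<^sup>2)"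
proof -
  have deg: "degree (x2m1 ^ n) = 2 * n" by (simp add: degree_power_eq)
  have lc: "lead_coeff (x2m1 ^ n) = 1" by (simp only: lead_coeff_power) simp
  have d: "degree ((pderiv ^^ j) q) = degree q - j" for q :: "real poly" and j
    by (induction j) (auto simp: degree_pderiv)
  have c: "coeff ((pderiv ^^ j) q) i = fact (i + j) / fact i * coeff q (i + j)"
    for q :: "real poly" and i j
  proof (induction j arbitrary: i)
    case (Suc j)
    have "fact (Suc i) = real (Suc i) * fact i" by simp
    then have "real (Suc i) * (fact (Suc i + j) / fact (Suc i) * x) = fact (Suc i + j) / fact i * x" for x
      by (simp del: of_nat_Suc)
    then show ?case by (simp add: coeff_pderiv Suc del: of_nat_Suc fact_Suc)
  qed simp
  show "degree (legendre n) = n" by (simp add: legendre_def d deg)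
  show "coeff (legendre n) n = fact (2 * n) / (2 ^ n * (fact n)\<^sup>2)"
    using lc by (simp add: legendre_def c deg mult_2 power2_eq_square)
qed

text \<open>The value of \<open>vcjh_eta\<close> is chosen precisely so that the top-order term of the inner product
  absorbs the \<open>legendre (p - 1)\<close> component of the correction function.\<close>

lemma integral_correction_pderiv:
  fixes A B c :: real
  assumes p: "p \<ge> 1" and r: "degree r \<le> p"
  defines "g \<equiv> smult A (legendre p)
    + smult B (smult (vcjh_eta p c) (legendre (p - 1)) + legendre (p + 1))"
  shows "poly_int (g * pderiv r)
    = c / 2 * poly_int ((pderiv ^^ p) (pderiv g) * (pderiv ^^ p) r)"
proof -
  have dr: "degree (pderiv r) \<le> p - 1" using r by (simp add: degree_pderiv)
  obtain n where n: "p = Suc n" using p by (cases p) auto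
  have dg: "degree (pderiv g) \<le> p"
  proof -
    have "degree g \<le> Suc p"
      unfolding g_def
      by (intro degree_add_le degree_smult_le[THEN order_trans]) (auto simp: degree_legendre)
    then show ?thesis by (simp add: degree_pderiv)
  qed
  \<comment> \<open>Only the component \<open>legendre (p + 1)\<close> reaches degree p + 1, so it
    alone determines the p-th derivative of \<open>pderiv g\<close>.\<close>
  have cg: "coeff g (Suc p) = B * (fact (2 * p + 2) / (2 ^ (p + 1) * (fact (p + 1))\<^sup>2))"
    using coeff_legendre[of "p + 1"]
    by (simp add: g_def coeff_eq_0 degree_legendre)
  have cr: "coeff (pderiv r) (p - 1) = p * coeff r p" using n by (simp add: coeff_pderiv)
  have z: "coeff (pderiv r) p = 0" "coeff (pderiv r) (p + 1) = 0"
    using dr p by (auto intro!: coeff_eq_0)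
  have "poly_int (g * pderiv r) = A * poly_int (legendre p * pderiv r)
      + B * (vcjh_eta p c * poly_int (legendre (p - 1) * pderiv r) + poly_int (legendre (p + 1) * pderiv r))"
    by (simp add: g_def distrib_right poly_int_add poly_int_smult)
  \<comment> \<open>The derivative of r has degree at most p - 1, hence is orthogonal to
    \<open>legendre p\<close> and \<open>legendre (p + 1)\<close>; only the component weighted by
    \<open>vcjh_eta\<close> survives.\<close>
  also have "\<dots> = B * vcjh_eta p c * (p * coeff r p)
      * (2 ^ (p - 1 + 1) * (fact (p - 1))\<^sup>2 / fact (2 * (p - 1) + 1))"
  proof -
    have "poly_int (legendre p * pderiv r) = 0" "poly_int (legendre (p + 1) * pderiv r) = 0"
      using integral_legendre_mult[of "pderiv r" p] integral_legendre_mult[of "pderiv r" "p + 1"] dr z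
      by simp_all
    then show ?thesis using integral_legendre_mult[of "pderiv r" "p - 1", OF dr] unfolding cr by simp
  qed
  finally have 1: "poly_int (g * pderiv r) = B * vcjh_eta p c * (p * coeff r p)
      * (2 ^ (p - 1 + 1) * (fact (p - 1))\<^sup>2 / fact (2 * (p - 1) + 1))" .
  have 2: "poly_int ((pderiv ^^ p) (pderiv g) * (pderiv ^^ p) r)
      = 2 * (fact p * coeff (pderiv g) p) * (fact p * coeff r p)"
    using poly_int_pderiv[of "[:0, fact p * coeff (pderiv g) p * (fact p * coeff r p):]"]
    by (simp add: funpow_pderiv_degree_le[OF dg] funpow_pderiv_degree_le[OF r] pderiv_pCons mult_ac)
  have cg': "coeff (pderiv g) p = (p + 1) * coeff g (Suc p)" by (simp add: coeff_pderiv)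
  \<comment> \<open>The balance that fixes \<open>vcjh_eta\<close>, as a rational identity in q = p,
    W = (2p - 1)!, P = 2^p, f = (p - 1)! and R, the p-th coefficient of r.\<close>
  have "B * (c * (2 * q + 1) * (2 * q * W / (P * (q * f)\<^sup>2) * (q * f))\<^sup>2 / 2) * (q * R) * (P * f\<^sup>2 / W)
      = c / 2 * (2 * (q * f * ((q + 1) * (B * ((2 * q + 2) * (2 * q + 1) * (2 * q * W)
          / (2 * P * ((q + 1) * (q * f))\<^sup>2))))) * (q * f * R))"
    if "q > 0" "W \<noteq> 0" "P \<noteq> 0" "f \<noteq> 0" for q W P f R :: real
  proof -
    have "q + 1 \<noteq> 0" "q \<noteq> 0" using that by auto
    then show ?thesis using that by (simp add: divide_simps power2_eq_square)
  qed
  note id = this[of "real p" "fact (2 * (p - 1) + 1)" "2 ^ p" "fact (p - 1)" "coeff r p"]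
  have f: "fact p = real p * fact (p - 1)" "fact (p + 1) = (real p + 1) * (real p * fact (p - 1))"
    "fact (2 * p) = 2 * real p * fact (2 * (p - 1) + 1)"
    "fact (2 * p + 2) = (2 * real p + 2) * (2 * real p + 1) * (2 * real p * fact (2 * (p - 1) + 1))"
    using fact_reduce[of p, where 'a = real] fact_reduce[of "p + 1", where 'a = real]
      fact_reduce[of "2 * p", where 'a = real] fact_reduce[of "2 * p + 1", where 'a = real]
      fact_reduce[of "2 * p + 2", where 'a = real]
    by (simp_all add: n)
  have e: "2 ^ (p - 1 + 1) = (2 ^ p :: real)" "2 ^ (p + 1) = (2 * 2 ^ p :: real)"
    "real (p + 1) = real p + 1"
    using p by simp_all
  show ?thesis
    unfolding 1 2 cg' cg vcjh_eta_def degree_legendre coeff_legendre f e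
    by (rule id) (use p in simp_all)
qed


lemma vcjh_eta_nonneg: "c \<ge> 0 \<Longrightarrow> vcjh_eta p c \<ge> 0"
  by (simp add: vcjh_eta_def)

lemma degree_correction_le: "degree (gR p c) \<le> Suc p" "degree (gL p c) \<le> Suc p"
  unfolding gR_def gL_def
  by (intro degree_smult_le[THEN order_trans] degree_add_le degree_diff_le;
      simp add: degree_legendre)+

text \<open>The indices p - 1 and p + 1 have the parity opposite to p, so the weighted mean of their
  Legendre polynomials is 1 at 1 and -(-1)^p at -1. Combined with \<open>legendre p\<close> it
  cancels at one end and adds up at the other. For c \<ge> 0 the denominator is positive.\<close>

lemma correction_boundary:
  assumes "p \<ge> 1" "c \<ge> 0"
  shows "poly (gR p c) 1 = 1" "poly (gR p c) (-1) = 0" "poly (gL p c) 1 = 0" "poly (gL p c) (-1) = 1"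
proof -
  obtain n where n: "p = Suc n" using assms by (cases p) auto
  have *: "1 + vcjh_eta p c \<noteq> 0" using vcjh_eta_nonneg[OF assms(2), of p] by linarith
  have s: "(-1) ^ p * (-1) ^ p = (1::real)" by simp
  have 1: "1 / (1 + vcjh_eta p c) * (vcjh_eta p c * 1 + 1) = 1"
    "1 / (1 + vcjh_eta p c) * (vcjh_eta p c * (-1) ^ (p - 1) + (-1) ^ (p + 1)) = - ((-1) ^ p)"
    using * by (simp_all add: n divide_simps) (simp_all add: algebra_simps)
  show "poly (gR p c) 1 = 1" "poly (gR p c) (-1) = 0" "poly (gL p c) 1 = 0" "poly (gL p c) (-1) = 1"
    unfolding gR_def gL_def poly_smult poly_add poly_diff legendre_boundary 1 using s by simp_all
qed

text \<open>After integration by parts the integral against the derivative of the test function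
  cancels the c-term, by the choice of \<open>vcjh_eta\<close>. Only boundary values remain, and the
  correction function vanishes at one end.\<close>

lemma vcjh_ip_correction:
  assumes p: "p \<ge> 1" and c: "c \<ge> 0" and f: "f \<in> P_space p"
  shows "vcjh_ip p c (poly (pderiv (gR p c))) f = f 1"
    and "vcjh_ip p c (poly (pderiv (gL p c))) f = - f (-1)"
proof -
  obtain r where r: "degree r \<le> p" "f = poly r" using f by (rule P_spaceE)
  define K where "K = smult (vcjh_eta p c) (legendre (p - 1)) + legendre (p + 1)"
  \<comment> \<open>The coefficients A and B are free, so that both correction functions are
    instances with the same K.\<close>
  have *: "vcjh_ip p c (poly (pderiv g)) f = poly g 1 * f 1 - poly g (-1) * f (-1)"
    if "g = smult A (legendre p) + smult B K" for g A B
    using poly_int_by_parts[of g r] integral_correction_pderiv[OF p r(1), of A B c]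
    unfolding that K_def by (simp add: r vcjh_ip_poly)
  have "gR p c = smult (1 / 2) (legendre p) + smult (1 / (2 * (1 + vcjh_eta p c))) K"
    by (simp add: gR_def K_def smult_add_right)
  from *[OF this] show "vcjh_ip p c (poly (pderiv (gR p c))) f = f 1"
    by (simp add: correction_boundary[OF p c])
  have "gL p c = smult ((-1) ^ p / 2) (legendre p) + smult (- ((-1) ^ p / (2 * (1 + vcjh_eta p c)))) K"
    by (simp add: gL_def K_def smult_diff_right)
  from *[OF this] show "vcjh_ip p c (poly (pderiv (gL p c))) f = - f (-1)"
    by (simp add: correction_boundary[OF p c])
qed

section \<open>Polynomials of two variables\<close>

definition tensor :: "(real \<Rightarrow> real) \<Rightarrow> (real \<Rightarrow> real) \<Rightarrow> real \<times> real \<Rightarrow> real" where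
  "tensor f g z = f (fst z) * g (snd z)"

definition face_trace :: "side \<Rightarrow> (real \<times> real \<Rightarrow> real) \<Rightarrow> real \<Rightarrow> real" where
  "face_trace f v s = v (ref_pt f s)"

lemma P_space_expansion:
  assumes "f \<in> P_space p"
  obtains a where "f = (\<lambda>x. \<Sum>i\<le>p. a i * x ^ i)"
proof -
  obtain q where q: "degree q \<le> p" "f = poly q" using assms by (rule P_spaceE)
  have "poly q x = (\<Sum>i\<le>p. coeff q i * x ^ i)" for x
    unfolding poly_altdef using q(1)
    by (intro sum.mono_neutral_left) (auto simp: coeff_eq_0)
  then show ?thesis using that q by blast
qed

lemma monomial_P_space: "i \<le> p \<Longrightarrow> (\<lambda>x. a * x ^ i) \<in> P_space p"
proof -
  assume "i \<le> p"
  moreover have "(\<lambda>x. a * x ^ i) = poly (monom a i)" by (auto simp: poly_monom)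
  ultimately show ?thesis using P_space_poly degree_monom_le order_trans by metis
qed

lemma tensor_Q_space:
  assumes "f \<in> P_space p" "g \<in> P_space p"
  shows "tensor f g \<in> Q_space p"
proof -
  obtain a b where "f = (\<lambda>x. \<Sum>i\<le>p. a i * x ^ i)" "g = (\<lambda>x. \<Sum>i\<le>p. b i * x ^ i)"
    using P_space_expansion[OF assms(1)] P_space_expansion[OF assms(2)] by metis
  then have "tensor f g = (\<lambda>z. \<Sum>i\<le>p. \<Sum>j\<le>p. a i * b j * fst z ^ i * snd z ^ j)"
    by (auto simp: tensor_def fun_eq_iff sum_product mult_ac)
  then show ?thesis unfolding Q_space_def by (intro CollectI exI[of _ "\<lambda>i j. a i * b j"])
qed

lemma Q_space_add:
  assumes "v \<in> Q_space p" "w \<in> Q_space p"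
  shows "(\<lambda>z. v z + w z) \<in> Q_space p"
proof -
  obtain a b where "v = (\<lambda>z. \<Sum>i\<le>p. \<Sum>j\<le>p. a i j * fst z ^ i * snd z ^ j)"
    "w = (\<lambda>z. \<Sum>i\<le>p. \<Sum>j\<le>p. b i j * fst z ^ i * snd z ^ j)"
    using assms unfolding Q_space_def by blast
  then have "(\<lambda>z. v z + w z) = (\<lambda>z. \<Sum>i\<le>p. \<Sum>j\<le>p. (a i j + b i j) * fst z ^ i * snd z ^ j)"
    by (simp add: sum.distrib algebra_simps)
  then show ?thesis unfolding Q_space_def by (intro CollectI exI[of _ "\<lambda>i j. a i j + b i j"])
qed

text \<open>Bilinear identities need checking on products only, where they factor into
  one-dimensional ones. A scalar is absorbed into a factor, so scaling needs no case.\<close>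

lemma Q_space_induct [consumes 1, case_names tensor add]:
  assumes "v \<in> Q_space p"
    and tensor: "\<And>f g. f \<in> P_space p \<Longrightarrow> g \<in> P_space p \<Longrightarrow> R (tensor f g)"
    and add: "\<And>v w. v \<in> Q_space p \<Longrightarrow> w \<in> Q_space p \<Longrightarrow> R v \<Longrightarrow> R w \<Longrightarrow> R (\<lambda>z. v z + w z)"
  shows "R v"
proof -
  \<comment> \<open>Membership in \<open>Q_space\<close> travels with R, since the rule
    \<open>add\<close> asks for it on partial sums.\<close>
  define T where "T = (\<lambda>v. v \<in> Q_space p \<and> R v)"
  have T_tensor: "T (tensor f g)" if "f \<in> P_space p" "g \<in> P_space p" for f g
    using that tensor tensor_Q_space by (simp add: T_def)
  have T_sum: "T (\<lambda>z. \<Sum>i\<in>S. F i z)" if "finite S" "\<And>i. i \<in> S \<Longrightarrow> T (F i)"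
    for S :: "nat set" and F
    using that
  proof (induction S)
    case empty
    have "(\<lambda>z. 0) = tensor (\<lambda>x. 0) (\<lambda>x. 0)" by (auto simp: tensor_def)
    then show ?case using T_tensor[OF P_space_zero P_space_zero] by simp
  next
    case (insert i S)
    then show ?case using add Q_space_add by (simp add: T_def)
  qed
  obtain a where a: "v = (\<lambda>z. \<Sum>i\<le>p. \<Sum>j\<le>p. a i j * fst z ^ i * snd z ^ j)"
    using assms(1) unfolding Q_space_def by blast
  have "T (\<lambda>z. a i j * fst z ^ i * snd z ^ j)" if "i \<in> {..p}" "j \<in> {..p}" for i j
    using T_tensor[of "\<lambda>x. a i j * x ^ i" "\<lambda>y. y ^ j"] that monomial_P_space[of j p 1]
    by (auto simp: monomial_P_space tensor_def[abs_def])
  then have "T v" unfolding a by (intro T_sum) auto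
  then show ?thesis by (simp add: T_def)
qed

lemma Q_space_scale:
  assumes "v \<in> Q_space p"
  shows "(\<lambda>z. a * v z) \<in> Q_space p"
  using assms
proof (induction rule: Q_space_induct)
  case (tensor f g)
  have "(\<lambda>z. a * tensor f g z) = tensor (\<lambda>x. a * f x) g" by (auto simp: tensor_def)
  then show ?case using tensor by (simp add: tensor_Q_space P_space_scale)
next
  case (add v w)
  then show ?case using Q_space_add by (simp add: distrib_left)
qed

lemma Q_space_diff:
  assumes "v \<in> Q_space p" "w \<in> Q_space p"
  shows "(\<lambda>z. v z - w z) \<in> Q_space p"
  using Q_space_add[OF assms(1) Q_space_scale[OF assms(2), of "-1"]] by simp

lemma Q_space_zero: "(\<lambda>z. 0) \<in> Q_space p"
  using tensor_Q_space[OF P_space_zero P_space_zero, of p] by (simp add: tensor_def[abs_def])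

lemma Q_space_sum:
  assumes "\<And>i. i \<in> S \<Longrightarrow> v i \<in> Q_space p"
  shows "(\<lambda>z. \<Sum>i\<in>S. v i z) \<in> Q_space p"
  using assms by (induction S rule: infinite_finite_induct) (auto simp: Q_space_zero Q_space_add)

lemma Q_space_slice:
  assumes "v \<in> Q_space p"
  shows "(\<lambda>x. v (x, y)) \<in> P_space p" "(\<lambda>y. v (x, y)) \<in> P_space p"
  using assms
proof (induction rule: Q_space_induct)
  case (tensor f g)
  show "(\<lambda>x. tensor f g (x, y)) \<in> P_space p"
    using P_space_scale[OF tensor(1), of "g y"] by (simp add: tensor_def mult.commute)
  show "(\<lambda>y. tensor f g (x, y)) \<in> P_space p"
    using P_space_scale[OF tensor(2), of "f x"] by (simp add: tensor_def)
qed (auto simp: P_space_add)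

lemma face_trace_P_space:
  assumes "v \<in> Q_space p"
  shows "face_trace f v \<in> P_space p"
  using Q_space_slice[OF assms] by (cases f) (auto simp: face_trace_def[abs_def])

lemma continuous_on_Q_space:
  assumes "v \<in> Q_space p"
  shows "continuous_on S v"
  using assms
proof (induction rule: Q_space_induct)
  case (tensor f g)
  then obtain q r where "f = poly q" "g = poly r" by (meson P_spaceE)
  then show ?case by (auto simp: tensor_def[abs_def] intro!: continuous_intros)
qed (auto intro: continuous_intros)

text \<open>The two degrees may differ because a correction function has degree up to p + 1 in the
  normal direction and p in the tangential one.\<close>

lemma d_tensor:
  assumes "f \<in> P_space p" "g \<in> P_space q"
  shows "d_xi (tensor f g) = tensor (deriv f) g" "d_eta (tensor f g) = tensor f (deriv g)"
proof -
  obtain P Q where q: "f = poly P" "g = poly Q" using assms by (meson P_spaceE)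
  have "deriv (\<lambda>x. poly P x * a) x = poly (pderiv P) x * a" for P and a x :: real
    by (rule DERIV_imp_deriv) (auto intro!: derivative_eq_intros)
  from this this[unfolded mult.commute[of "poly _ _"]]
  show "d_xi (tensor f g) = tensor (deriv f) g" "d_eta (tensor f g) = tensor f (deriv g)"
    by (auto simp: fun_eq_iff q d_xi_def d_eta_def tensor_def)
qed

lemma d_add:
  assumes "v \<in> Q_space p" "w \<in> Q_space p"
  shows "d_xi (\<lambda>z. v z + w z) = (\<lambda>z. d_xi v z + d_xi w z)"
    and "d_eta (\<lambda>z. v z + w z) = (\<lambda>z. d_eta v z + d_eta w z)"
  using higher_deriv_add_P_space[OF Q_space_slice(1)[OF assms(1)] Q_space_slice(1)[OF assms(2)], of 1]
    higher_deriv_add_P_space[OF Q_space_slice(2)[OF assms(1)] Q_space_slice(2)[OF assms(2)], of 1]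
  by (auto simp: d_xi_def d_eta_def fun_eq_iff)

lemma d_scale:
  assumes "v \<in> Q_space p"
  shows "d_xi (\<lambda>z. a * v z) = (\<lambda>z. a * d_xi v z)"
    and "d_eta (\<lambda>z. a * v z) = (\<lambda>z. a * d_eta v z)"
  using higher_deriv_scale_P_space[OF Q_space_slice(1)[OF assms], of 1]
    higher_deriv_scale_P_space[OF Q_space_slice(2)[OF assms], of 1]
  by (auto simp: d_xi_def d_eta_def fun_eq_iff)

lemma d_Q_space:
  assumes "v \<in> Q_space p"
  shows "d_xi v \<in> Q_space p" "d_eta v \<in> Q_space p"
  using assms
proof (induction rule: Q_space_induct)
  case (tensor f g)
  then show "d_xi (tensor f g) \<in> Q_space p" "d_eta (tensor f g) \<in> Q_space p"
    using higher_deriv_P_space[OF tensor(1), of 1] higher_deriv_P_space[OF tensor(2), of 1]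
    by (auto simp: d_tensor[OF tensor] intro!: tensor_Q_space)
qed (auto simp: d_add Q_space_add)

lemma higher_d_Q_space:
  assumes "v \<in> Q_space p"
  shows "(d_xi ^^ n) v \<in> Q_space p" "(d_eta ^^ n) v \<in> Q_space p"
  using assms by (induction n) (auto simp: d_Q_space)

lemma higher_d_add:
  assumes "v \<in> Q_space p" "w \<in> Q_space p"
  shows "(d_xi ^^ n) (\<lambda>z. v z + w z) = (\<lambda>z. (d_xi ^^ n) v z + (d_xi ^^ n) w z)"
    and "(d_eta ^^ n) (\<lambda>z. v z + w z) = (\<lambda>z. (d_eta ^^ n) v z + (d_eta ^^ n) w z)"
  by (induction n) (simp_all add: d_add[OF higher_d_Q_space(1)[OF assms(1)] higher_d_Q_space(1)[OF assms(2)]]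
    d_add[OF higher_d_Q_space(2)[OF assms(1)] higher_d_Q_space(2)[OF assms(2)]])

lemma higher_d_scale:
  assumes "v \<in> Q_space p"
  shows "(d_xi ^^ n) (\<lambda>z. a * v z) = (\<lambda>z. a * (d_xi ^^ n) v z)"
    and "(d_eta ^^ n) (\<lambda>z. a * v z) = (\<lambda>z. a * (d_eta ^^ n) v z)"
  by (induction n) (simp_all add: d_scale[OF higher_d_Q_space(1)[OF assms]]
    d_scale[OF higher_d_Q_space(2)[OF assms]])

lemma higher_d_tensor:
  assumes "f \<in> P_space p" "g \<in> P_space p"
  shows "(d_xi ^^ n) (tensor f g) = tensor ((deriv ^^ n) f) g"
    and "(d_eta ^^ n) (tensor f g) = tensor f ((deriv ^^ n) g)"
  by (induction n) (simp_all add: d_tensor[OF higher_deriv_P_space[OF assms(1)] assms(2)]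
    d_tensor[OF assms(1) higher_deriv_P_space[OF assms(2)]])

section \<open>The two-dimensional inner product\<close>

definition sobolev_density ::
    "nat \<Rightarrow> real \<Rightarrow> (real \<times> real \<Rightarrow> real) \<Rightarrow> (real \<times> real \<Rightarrow> real) \<Rightarrow> real \<times> real \<Rightarrow> real" where
  "sobolev_density p c v w z = v z * w z
     + c / 2 * ((d_xi ^^ p) v z * (d_xi ^^ p) w z + (d_eta ^^ p) v z * (d_eta ^^ p) w z)
     + c\<^sup>2 / 4 * ((d_xi ^^ p) ((d_eta ^^ p) v) z * (d_xi ^^ p) ((d_eta ^^ p) w) z)"

definition sobolev_ip ::
    "nat \<Rightarrow> real \<Rightarrow> (real \<times> real \<Rightarrow> real) \<Rightarrow> (real \<times> real \<Rightarrow> real) \<Rightarrow> real" where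
  "sobolev_ip p c v w = integral (cbox (-1, -1) (1, 1)) (sobolev_density p c v w)"

lemma continuous_on_sobolev_density:
  assumes "v \<in> Q_space p" "w \<in> Q_space p"
  shows "continuous_on S (sobolev_density p c v w)"
  unfolding sobolev_density_def[abs_def]
  by (intro continuous_intros continuous_on_Q_space[of _ p] higher_d_Q_space assms)

lemma integrable_sobolev_density:
  assumes "v \<in> Q_space p" "w \<in> Q_space p"
  shows "sobolev_density p c v w integrable_on cbox a b"
  by (intro integrable_continuous continuous_on_sobolev_density assms)

lemma sobolev_ip_commute: "sobolev_ip p c v w = sobolev_ip p c w v"
  by (simp add: sobolev_ip_def sobolev_density_def[abs_def] mult.commute)

lemma sobolev_ip_add_left:
  assumes "v \<in> Q_space p" "w \<in> Q_space p" "r \<in> Q_space p"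
  shows "sobolev_ip p c (\<lambda>z. v z + w z) r = sobolev_ip p c v r + sobolev_ip p c w r"
proof -
  have "sobolev_density p c (\<lambda>z. v z + w z) r
      = (\<lambda>z. sobolev_density p c v r z + sobolev_density p c w r z)"
    by (simp add: sobolev_density_def[abs_def] higher_d_add[OF assms(1,2)]
      higher_d_add[OF higher_d_Q_space(2)[OF assms(1)] higher_d_Q_space(2)[OF assms(2)]]
      algebra_simps add_divide_distrib)
  then show ?thesis
    using integral_add[OF integrable_sobolev_density[OF assms(1,3)]
        integrable_sobolev_density[OF assms(2,3)]] by (simp add: sobolev_ip_def)
qed

lemma sobolev_ip_scale_left:
  assumes "v \<in> Q_space p"
  shows "sobolev_ip p c (\<lambda>z. a * v z) r = a * sobolev_ip p c v r"
proof -
  have "sobolev_density p c (\<lambda>z. a * v z) r = (\<lambda>z. a * sobolev_density p c v r z)"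
    by (simp add: sobolev_density_def[abs_def] higher_d_scale[OF assms]
      higher_d_scale[OF higher_d_Q_space(2)[OF assms]] algebra_simps)
  then show ?thesis by (simp add: sobolev_ip_def)
qed

lemma sobolev_ip_add_right:
  assumes "v \<in> Q_space p" "w \<in> Q_space p" "r \<in> Q_space p"
  shows "sobolev_ip p c r (\<lambda>z. v z + w z) = sobolev_ip p c r v + sobolev_ip p c r w"
  using sobolev_ip_add_left[OF assms] by (simp add: sobolev_ip_commute)

lemma sobolev_ip_diff_left:
  assumes "v \<in> Q_space p" "w \<in> Q_space p" "r \<in> Q_space p"
  shows "sobolev_ip p c (\<lambda>z. v z - w z) r = sobolev_ip p c v r - sobolev_ip p c w r"
  using sobolev_ip_add_left[OF assms(1) Q_space_scale[OF assms(2), of "-1"] assms(3)]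
    sobolev_ip_scale_left[OF assms(2), of c "-1"] by simp

lemma sobolev_ip_diff_right:
  assumes "v \<in> Q_space p" "w \<in> Q_space p" "r \<in> Q_space p"
  shows "sobolev_ip p c r (\<lambda>z. v z - w z) = sobolev_ip p c r v - sobolev_ip p c r w"
  using sobolev_ip_diff_left[OF assms] by (simp add: sobolev_ip_commute)

lemma sobolev_ip_zero_left: "sobolev_ip p c (\<lambda>z. 0) r = 0"
  using sobolev_ip_scale_left[OF Q_space_zero, of p c 0] by simp

lemma sobolev_ip_sum_left:
  assumes "\<And>i. i \<in> S \<Longrightarrow> v i \<in> Q_space p" "r \<in> Q_space p"
  shows "sobolev_ip p c (\<lambda>z. \<Sum>i\<in>S. v i z) r = (\<Sum>i\<in>S. sobolev_ip p c (v i) r)"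
  using assms(1)
  by (induction S rule: infinite_finite_induct)
    (auto simp: sobolev_ip_zero_left sobolev_ip_add_left Q_space_sum assms(2))

lemma sobolev_ip_nonneg:
  assumes "v \<in> Q_space p" "c \<ge> 0"
  shows "sobolev_ip p c v v \<ge> 0"
  unfolding sobolev_ip_def using assms
  by (intro integral_nonneg integrable_sobolev_density) (auto simp: sobolev_density_def)

text \<open>The weights 1, c/2, c/2 and c^2/4 are those of the product of two one-dimensional
  integrands. The density factorises, and so does the iterated integral.\<close>

lemma sobolev_ip_tensor:
  assumes "f \<in> P_space p" "g \<in> P_space p" "F \<in> P_space p" "G \<in> P_space p"
  shows "sobolev_ip p c (tensor f g) (tensor F G) = vcjh_ip p c f F * vcjh_ip p c g G"
proof -
  define A where "A = (\<lambda>f F x. f x * F x + c / 2 * ((deriv ^^ p) f x * (deriv ^^ p) F x))"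
  have "sobolev_density p c (tensor f g) (tensor F G) (x, y) = A f F x * A g G y" for x y
    by (simp add: sobolev_density_def A_def higher_d_tensor[OF assms(1,2)] higher_d_tensor[OF assms(3,4)]
      higher_d_tensor[OF assms(1) higher_deriv_P_space[OF assms(2)]]
      higher_d_tensor[OF assms(3) higher_deriv_P_space[OF assms(4)]])
      (simp add: tensor_def algebra_simps power2_eq_square)
  then have "sobolev_ip p c (tensor f g) (tensor F G)
      = integral {-1..1} (\<lambda>x. integral {-1..1} (\<lambda>y. A f F x * A g G y))"
    using integral_prod_continuous[OF continuous_on_sobolev_density, of "tensor f g" p "tensor F G"
        "-1" "-1" 1 1 c] assms
    by (simp add: sobolev_ip_def tensor_Q_space)
  then show ?thesis by (simp add: vcjh_ip_def A_def)
qed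

lemma vcjh_ip_by_parts_P_space:
  assumes "f \<in> P_space p" "g \<in> P_space p"
  shows "vcjh_ip p c (deriv f) g + vcjh_ip p c f (deriv g) = f 1 * g 1 - f (-1) * g (-1)"
  using assms vcjh_ip_by_parts by (auto elim!: P_spaceE)

lemma deriv_P_space: "f \<in> P_space p \<Longrightarrow> deriv f \<in> P_space p"
  using higher_deriv_P_space[of f p 1] by simp

lemma face_trace_add: "face_trace f (\<lambda>z. v z + w z) = (\<lambda>s. face_trace f v s + face_trace f w s)"
  by (simp add: face_trace_def fun_eq_iff)

lemma face_trace_tensor:
  "face_trace East (tensor f g) = (\<lambda>s. f 1 * g s)" "face_trace West (tensor f g) = (\<lambda>s. f (-1) * g s)"
  "face_trace North (tensor f g) = (\<lambda>s. g 1 * f s)" "face_trace South (tensor f g) = (\<lambda>s. g (-1) * f s)"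
  by (simp_all add: face_trace_def tensor_def fun_eq_iff)

text \<open>Integration by parts is exact for this inner product because the top derivatives of
  \<open>d_xi v\<close> vanish.\<close>

lemma sobolev_ip_by_parts:
  assumes "v \<in> Q_space p" "w \<in> Q_space p"
  shows "sobolev_ip p c (d_xi v) w + sobolev_ip p c v (d_xi w)
      = vcjh_ip p c (face_trace East v) (face_trace East w) - vcjh_ip p c (face_trace West v) (face_trace West w)"
    and "sobolev_ip p c (d_eta v) w + sobolev_ip p c v (d_eta w)
      = vcjh_ip p c (face_trace North v) (face_trace North w) - vcjh_ip p c (face_trace South v) (face_trace South w)"
proof -
  \<comment> \<open>Both directions form one relation, proved by a single nested induction, first
    over v and then over w.\<close>
  define R where "R v w \<longleftrightarrow>
      sobolev_ip p c (d_xi v) w + sobolev_ip p c v (d_xi w)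
        = vcjh_ip p c (face_trace East v) (face_trace East w) - vcjh_ip p c (face_trace West v) (face_trace West w) \<and>
      sobolev_ip p c (d_eta v) w + sobolev_ip p c v (d_eta w)
        = vcjh_ip p c (face_trace North v) (face_trace North w) - vcjh_ip p c (face_trace South v) (face_trace South w)" for v w
  have "R v w"
    using assms(1)
  proof (induction rule: Q_space_induct)
    case (tensor f g)
    note fg = tensor
    from assms(2) show ?case
    proof (induction rule: Q_space_induct)
      case (tensor F G)
      have "vcjh_ip p c (deriv f) F * vcjh_ip p c g G + vcjh_ip p c f (deriv F) * vcjh_ip p c g G
          = (f 1 * F 1 - f (-1) * F (-1)) * vcjh_ip p c g G"
        "vcjh_ip p c f F * vcjh_ip p c (deriv g) G + vcjh_ip p c f F * vcjh_ip p c g (deriv G)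
          = vcjh_ip p c f F * (g 1 * G 1 - g (-1) * G (-1))"
        using vcjh_ip_by_parts_P_space[OF fg(1) tensor(1), of c] vcjh_ip_by_parts_P_space[OF fg(2) tensor(2), of c]
        by (simp_all flip: distrib_left distrib_right)
      then show ?case
        using fg tensor
        by (simp add: R_def d_tensor[OF fg] d_tensor[OF tensor] sobolev_ip_tensor deriv_P_space face_trace_tensor
          vcjh_ip_scale_left vcjh_ip_scale_right) (simp add: algebra_simps)
    next
      case (add w r)
      then show ?case
        using tensor_Q_space[OF fg]
        by (simp add: R_def d_add sobolev_ip_add_right d_Q_space face_trace_add vcjh_ip_add_right face_trace_P_space)
    qed
  next
    case (add v r)
    then show ?case
      using assms(2) by (simp add: R_def d_add sobolev_ip_add_left d_Q_space face_trace_add vcjh_ip_add_left face_trace_P_space)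
  qed
  then show "sobolev_ip p c (d_xi v) w + sobolev_ip p c v (d_xi w)
      = vcjh_ip p c (face_trace East v) (face_trace East w) - vcjh_ip p c (face_trace West v) (face_trace West w)"
    and "sobolev_ip p c (d_eta v) w + sobolev_ip p c v (d_eta w)
      = vcjh_ip p c (face_trace North v) (face_trace North w) - vcjh_ip p c (face_trace South v) (face_trace South w)"
    by (simp_all add: R_def)
qed

text \<open>The divergence of the correction field whose normal trace on the face is the given function
  (and zero on the other faces).\<close>

fun lift :: "nat \<Rightarrow> real \<Rightarrow> side \<Rightarrow> (real \<Rightarrow> real) \<Rightarrow> real \<times> real \<Rightarrow> real" where
  "lift p c East \<phi> = tensor (poly (pderiv (gR p c))) \<phi>"
| "lift p c West \<phi> = tensor (poly (pderiv (- gL p c))) \<phi>"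
| "lift p c North \<phi> = tensor \<phi> (poly (pderiv (gR p c)))"
| "lift p c South \<phi> = tensor \<phi> (poly (pderiv (- gL p c)))"

lemma correction_deriv_P_space:
  "poly (pderiv (gR p c)) \<in> P_space p" "poly (pderiv (- gL p c)) \<in> P_space p"
  using degree_correction_le[of p c] by (auto intro!: P_space_poly simp: degree_pderiv)

lemma lift_Q_space: "\<phi> \<in> P_space p \<Longrightarrow> lift p c f \<phi> \<in> Q_space p"
  by (cases f) (auto intro!: tensor_Q_space correction_deriv_P_space)

lemma vcjh_ip_correction_West:
  assumes "p \<ge> 1" "c \<ge> 0" "f \<in> P_space p"
  shows "vcjh_ip p c (poly (pderiv (- gL p c))) f = f (-1)"
proof -
  have "poly (pderiv (gL p c)) \<in> P_space p"
    using degree_correction_le[of p c] by (auto intro!: P_space_poly simp: degree_pderiv)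
  moreover have "poly (pderiv (- gL p c)) = (\<lambda>x. -1 * poly (pderiv (gL p c)) x)"
    by (simp add: pderiv_minus fun_eq_iff)
  ultimately show ?thesis using vcjh_ip_correction(2)[OF assms] by (simp only: vcjh_ip_scale_left)
qed

text \<open>The lift is the adjoint of the face trace for the two inner products: its normal factor
  represents evaluation at the end point, and its tangential factor is the datum itself.\<close>

lemma sobolev_ip_lift:
  assumes "p \<ge> 1" "c \<ge> 0" "\<phi> \<in> P_space p" "w \<in> Q_space p"
  shows "sobolev_ip p c (lift p c f \<phi>) w = vcjh_ip p c \<phi> (face_trace f w)"
  using assms(4)
proof (induction rule: Q_space_induct)
  case (tensor F G)
  then show ?case
    using assms correction_deriv_P_space[of p c]
    by (cases f) (auto simp: sobolev_ip_tensor face_trace_tensor vcjh_ip_scale_right vcjh_ip_correction vcjh_ip_correction_West)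
next
  case (add v w)
  then show ?case
    using assms by (simp add: sobolev_ip_add_right lift_Q_space face_trace_add vcjh_ip_add_right face_trace_P_space)
qed

lemma divg_corr:
  assumes "m \<in> {1..p + 1}"
  shows "divg (corr p c X f m) = lift p c f (lagrange p (X f) m)"
proof -
  note lag = lagrange_P_space[OF assms]
  note Suc_P = P_space_poly[OF degree_correction_le(1)] P_space_poly[of "- gL p c" "Suc p"]
  have z: "d_xi (\<lambda>y. 0) = (\<lambda>z. 0)" "d_eta (\<lambda>y. 0) = (\<lambda>z. 0)"
    by (simp_all add: d_xi_def d_eta_def fun_eq_iff)
  have deg: "degree (- gL p c) \<le> Suc p" using degree_correction_le by simp
  show ?thesis
  proof (cases f)
    case East
    then have "(\<lambda>y. fst (corr p c X f m y)) = tensor (poly (gR p c)) (lagrange p (X East) m)"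
      "(\<lambda>y. snd (corr p c X f m y)) = (\<lambda>y. 0)" by (auto simp: tensor_def)
    then show ?thesis using East
      by (simp add: divg_def[abs_def] d_tensor[OF Suc_P(1) lag] z)
  next
    case West
    then have "(\<lambda>y. fst (corr p c X f m y)) = tensor (poly (- gL p c)) (lagrange p (X West) m)"
      "(\<lambda>y. snd (corr p c X f m y)) = (\<lambda>y. 0)" by (auto simp: tensor_def)
    then show ?thesis using West
      by (simp add: divg_def[abs_def] d_tensor[OF Suc_P(2)[OF deg] lag] z)
  next
    case North
    then have "(\<lambda>y. snd (corr p c X f m y)) = tensor (lagrange p (X North) m) (poly (gR p c))"
      "(\<lambda>y. fst (corr p c X f m y)) = (\<lambda>y. 0)" by (auto simp: tensor_def)
    then show ?thesis using North
      by (simp add: divg_def[abs_def] d_tensor[OF lag Suc_P(1)] z)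
  next
    case South
    then have "(\<lambda>y. snd (corr p c X f m y)) = tensor (lagrange p (X South) m) (poly (- gL p c))"
      "(\<lambda>y. fst (corr p c X f m y)) = (\<lambda>y. 0)" by (auto simp: tensor_def)
    then show ?thesis using South
      by (simp add: divg_def[abs_def] d_tensor[OF lag Suc_P(2)[OF deg]] z)
  qed
qed

text \<open>The lift is linear in its datum, and a datum of degree at most p is its own interpolant.
  This removes the flux points from the analysis of the scheme.\<close>

lemma sum_divg_corr:
  assumes "\<phi> \<in> P_space p" "flux_points p X"
  shows "(\<Sum>m\<in>{1..p + 1}. divg (corr p c X f m) z * \<phi> (X f m)) = lift p c f \<phi> z"
proof -
  have inj: "inj_on (X f) {1..p + 1}" using assms(2) by (simp add: flux_points_def)
  have "(\<Sum>m\<in>{1..p + 1}. divg (corr p c X f m) z * \<phi> (X f m))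
      = (\<Sum>m\<in>{1..p + 1}. lift p c f (lagrange p (X f) m) z * \<phi> (X f m))"
    by (intro sum.cong) (simp_all only: divg_corr)
  also have "\<dots> = lift p c f (\<lambda>s. \<Sum>m\<in>{1..p + 1}. \<phi> (X f m) * lagrange p (X f) m s) z"
    by (cases f) (simp_all add: tensor_def sum_distrib_left sum_distrib_right mult_ac del: sum.cl_ivl_Suc)
  also have "\<dots> = lift p c f \<phi> z"
    by (simp only: lagrange_interpolation[OF assms(1) inj, symmetric])
  finally show ?thesis .
qed

section \<open>Nodal interpolation and differentiation in time\<close>

lemma Q_space_interpolation:
  assumes "v \<in> Q_space p" "inj_on x {1..p + 1}"
  shows "v z = (\<Sum>(m, n)\<in>{1..p + 1} \<times> {1..p + 1}. v (x m, x n) * tensor (lagrange p x m) (lagrange p x n) z)"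
proof -
  have "v z = (\<Sum>m\<in>{1..p + 1}. v (x m, snd z) * lagrange p x m (fst z))"
    using lagrange_interpolation[OF Q_space_slice(1)[OF assms(1)] assms(2), of "fst z" "snd z"] by simp
  also have "\<dots> = (\<Sum>m\<in>{1..p + 1}. \<Sum>n\<in>{1..p + 1}.
      v (x m, x n) * tensor (lagrange p x m) (lagrange p x n) z)"
    by (intro sum.cong refl,
      subst lagrange_interpolation[OF Q_space_slice(2)[OF assms(1)] assms(2)])
      (simp add: sum_distrib_left sum_distrib_right tensor_def mult_ac del: sum.cl_ivl_Suc)
  finally show ?thesis by (simp add: sum.cartesian_product del: sum.cl_ivl_Suc)
qed

lemma flux_points_square:
  assumes "flux_points p X" "m \<in> {1..p + 1}" "n \<in> {1..p + 1}"
  shows "(X f m, X f n) \<in> cbox (-1, -1) (1, 1)"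
proof -
  have "X f m \<in> {-1..1}" "X f n \<in> {-1..1}"
    using assms unfolding flux_points_def by blast+
  then show ?thesis by (simp add: cbox_Pair_eq)
qed

lemma Q_space_eqI:
  assumes "v \<in> Q_space p" "w \<in> Q_space p" "flux_points p X"
    and "\<And>z. z \<in> cbox (-1, -1) (1, 1) \<Longrightarrow> v z = w z"
  shows "v = w"
proof
  fix z
  \<comment> \<open>The flux points of one face, taken in both coordinates, form a tensor grid in
    the square; the choice of \<open>East\<close> is arbitrary.\<close>
  have inj: "inj_on (X East) {1..p + 1}" using assms(3) by (simp add: flux_points_def)
  show "v z = w z"
    unfolding Q_space_interpolation[OF assms(1) inj, of z] Q_space_interpolation[OF assms(2) inj, of z]
    using assms(4)[OF flux_points_square[OF assms(3)]]
    by (intro sum.cong refl) (clarify, simp only: split)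
qed

text \<open>Differentiability in time is known only pointwise in space. In nodal values the squared
  norm is a finite quadratic form with constant coefficients, so it can be differentiated without
  interchanging derivative and integral.\<close>

lemma sobolev_ip_has_derivative:
  assumes I: "open I" "t \<in> I" and X: "flux_points p X"
    and v: "\<And>\<tau>. \<tau> \<in> I \<Longrightarrow> v \<tau> \<in> Q_space p"
    and diff: "\<And>z. z \<in> cbox (-1, -1) (1, 1) \<Longrightarrow> (\<lambda>\<tau>. v \<tau> z) differentiable (at t)"
  obtains v' where "v' \<in> Q_space p"
    and "\<And>z. z \<in> cbox (-1, -1) (1, 1) \<Longrightarrow> deriv (\<lambda>\<tau>. v \<tau> z) t = v' z"
    and "((\<lambda>\<tau>. sobolev_ip p c (v \<tau>) (v \<tau>)) has_real_derivative 2 * sobolev_ip p c v' (v t)) (at t)"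
proof -
  define N where "N = {1..p + 1} \<times> {1..p + 1}"
  define b where "b = (\<lambda>(m, n). tensor (lagrange p (X East) m) (lagrange p (X East) n))"
  define x where "x = (\<lambda>(m, n). (X East m, X East n))"
  \<comment> \<open>The interpolant of the time derivatives at the nodes.\<close>
  define v' where "v' = (\<lambda>z. \<Sum>i\<in>N. deriv (\<lambda>\<tau>. v \<tau> (x i)) t * b i z)"
  have b: "b i \<in> Q_space p" if "i \<in> N" for i
    using that lagrange_P_space by (auto simp: N_def b_def intro!: tensor_Q_space)
  have x: "x i \<in> cbox (-1, -1) (1, 1)" if "i \<in> N" for i
    using that flux_points_square[OF X] by (auto simp: N_def x_def)
  have D: "((\<lambda>\<tau>. v \<tau> z) has_real_derivative deriv (\<lambda>\<tau>. v \<tau> z) t) (at t)"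
    if "z \<in> cbox (-1, -1) (1, 1)" for z
    using diff[OF that] by (simp add: DERIV_deriv_iff_real_differentiable)
  have inj: "inj_on (X East) {1..p + 1}" using X by (simp add: flux_points_def)
  have nodal: "v \<tau> = (\<lambda>z. \<Sum>i\<in>N. v \<tau> (x i) * b i z)" if "\<tau> \<in> I" for \<tau>
    by (rule ext, rule trans[OF Q_space_interpolation[OF v[OF that] inj]])
      (simp add: N_def x_def b_def case_prod_unfold del: sum.cl_ivl_Suc)
  have sobolev_ip_nodal: "sobolev_ip p c (\<lambda>z. \<Sum>i\<in>N. a i * b i z) r = (\<Sum>i\<in>N. a i * sobolev_ip p c (b i) r)"
    if "r \<in> Q_space p" for a r
    using that by (subst sobolev_ip_sum_left) (auto intro!: Q_space_scale sum.cong simp: sobolev_ip_scale_left b)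
  have Qn: "(\<lambda>z. \<Sum>i\<in>N. a i * b i z) \<in> Q_space p" for a
    by (intro Q_space_sum Q_space_scale b)
  have qip2: "sobolev_ip p c (\<lambda>z. \<Sum>i\<in>N. a i * b i z) (\<lambda>z. \<Sum>i\<in>N. d i * b i z)
      = (\<Sum>i\<in>N. \<Sum>j\<in>N. a i * d j * sobolev_ip p c (b i) (b j))" for a d
  proof -
    have "sobolev_ip p c (b i) (\<lambda>z. \<Sum>i\<in>N. d i * b i z) = (\<Sum>j\<in>N. d j * sobolev_ip p c (b i) (b j))"
      if "i \<in> N" for i
      using sobolev_ip_nodal[OF b[OF that], of d] by (simp add: sobolev_ip_commute[of p c "b i"])
    then show ?thesis by (simp add: sobolev_ip_nodal[OF Qn] sum_distrib_left mult.assoc)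
  qed
  have Dx: "((\<lambda>\<tau>. v \<tau> (x i)) has_real_derivative deriv (\<lambda>\<tau>. v \<tau> (x i)) t) (at t)" if "i \<in> N" for i
    by (rule D[OF x[OF that]])
  show thesis
  proof (rule that[of v'])
    show v'Q: "v' \<in> Q_space p" unfolding v'_def by (rule Qn)
    show "deriv (\<lambda>\<tau>. v \<tau> z) t = v' z" if "z \<in> cbox (-1, -1) (1, 1)" for z
    proof -
      have "((\<lambda>\<tau>. \<Sum>i\<in>N. v \<tau> (x i) * b i z) has_real_derivative v' z) (at t)"
        unfolding v'_def by (auto intro!: derivative_eq_intros Dx)
      \<comment> \<open>The nodal expansion holds for times in I only; openness of I lets the
        derivative be transferred.\<close>
      moreover have "(\<Sum>i\<in>N. v \<tau> (x i) * b i z) = v \<tau> z" if "\<tau> \<in> I" for \<tau>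
        using fun_cong[OF nodal[OF that], of z] by (rule sym)
      ultimately have "((\<lambda>\<tau>. v \<tau> z) has_real_derivative v' z) (at t)"
        by (rule has_field_derivative_transform_within_open[OF _ I])
      then show ?thesis by (rule DERIV_imp_deriv)
    qed
    define v1 where "v1 i = deriv (\<lambda>\<tau>. v \<tau> (x i)) t" for i
    have "((\<lambda>\<tau>. \<Sum>i\<in>N. \<Sum>j\<in>N. v \<tau> (x i) * v \<tau> (x j) * sobolev_ip p c (b i) (b j)) has_real_derivative
        (\<Sum>i\<in>N. \<Sum>j\<in>N. (v1 i * v t (x j) + v1 j * v t (x i)) * sobolev_ip p c (b i) (b j))) (at t)"
      unfolding v1_def by (intro DERIV_sum DERIV_cmult_right DERIV_mult Dx)
    also have "(\<Sum>i\<in>N. \<Sum>j\<in>N. (v1 i * v t (x j) + v1 j * v t (x i)) * sobolev_ip p c (b i) (b j))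
        = (\<Sum>i\<in>N. \<Sum>j\<in>N. v1 i * v t (x j) * sobolev_ip p c (b i) (b j))
        + (\<Sum>i\<in>N. \<Sum>j\<in>N. v t (x i) * v1 j * sobolev_ip p c (b i) (b j))"
      by (simp only: distrib_right sum.distrib mult.commute[of "v1 _" "v t _"])
    also have "\<dots> = 2 * sobolev_ip p c v' (v t)"
      unfolding qip2[symmetric] v'_def[folded v1_def, symmetric] nodal[OF I(2), symmetric]
      by (simp add: sobolev_ip_commute)
    finally have "((\<lambda>\<tau>. \<Sum>i\<in>N. \<Sum>j\<in>N. v \<tau> (x i) * v \<tau> (x j) * sobolev_ip p c (b i) (b j))
        has_real_derivative 2 * sobolev_ip p c v' (v t)) (at t)" .
    moreover have "(\<Sum>i\<in>N. \<Sum>j\<in>N. v \<tau> (x i) * v \<tau> (x j) * sobolev_ip p c (b i) (b j)) = sobolev_ip p c (v \<tau>) (v \<tau>)"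
      if "\<tau> \<in> I" for \<tau>
      unfolding qip2[symmetric] nodal[OF that, symmetric] by (rule refl)
    ultimately show "((\<lambda>\<tau>. sobolev_ip p c (v \<tau>) (v \<tau>)) has_real_derivative 2 * sobolev_ip p c v' (v t)) (at t)"
      by (rule has_field_derivative_transform_within_open[OF _ I])
  qed
qed

section \<open>The energy balance of one element\<close>

text \<open>The energy balance after bilinear expansion. The prefixes x and y mark pairings on the
  faces A and B, and the letters v, w, q name the paired traces of solution, trace variable and
  gradient; b is \<beta> / K and qq the square of q. The mixed terms in q cancel, and the rest
  completes to squares of v - w.\<close>

lemma completed_square:
  fixes a b J sA sB :: real
  shows "J * (a * xwv - b * xqv + sA * (xvv - xwv)) + J * (- a * ywv + b * yqv + sB * (yvv - ywv))
      - J * (a * ((xvv - yvv) / 2) - b * (qq - (xqw - xqv - (yqw - yqv))))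
      - (J * (a * xww - b * xqw + sA * (xwv - xww)) + J * (- a * yww + b * yqw + sB * (ywv - yww))
        - J * a / 2 * (xww - yww))
    = J * ((sA - a / 2) * (xvv - 2 * xwv + xww) + (sB + a / 2) * (yvv - 2 * ywv + yww) + b * qq)"
  by (simp add: field_simps)

text \<open>\<open>D\<close> stands for \<open>d_xi\<close> or \<open>d_eta\<close>, \<open>A\<close> and \<open>B\<close> for the two faces where the coordinate is \<open>1\<close> and
  \<open>-1\<close>, \<open>J\<close> for their face Jacobian and \<open>K\<close> for the other diagonal entry of the Jacobian matrix.\<close>

lemma directional_energy:
  fixes a J K \<beta> sA sB :: real
  assumes p: "p \<ge> 1" and c: "c \<ge> 0" and \<beta>: "\<beta> \<ge> 0" and J: "J > 0" and K: "K > 0"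
    and D_Q: "\<And>v. v \<in> Q_space p \<Longrightarrow> D v \<in> Q_space p"
    and by_parts: "\<And>v w. v \<in> Q_space p \<Longrightarrow> w \<in> Q_space p \<Longrightarrow>
      sobolev_ip p c (D v) w + sobolev_ip p c v (D w)
        = vcjh_ip p c (face_trace A v) (face_trace A w) - vcjh_ip p c (face_trace B v) (face_trace B w)"
    and v: "v \<in> Q_space p" and wA: "wA \<in> P_space p" and wB: "wB \<in> P_space p"
    and sA: "sA > a / 2" and sB: "sB > - a / 2"
    and q: "q = (\<lambda>z. D v z + (lift p c A (\<lambda>s. wA s - face_trace A v s) z - lift p c B (\<lambda>s. wB s - face_trace B v s) z))"
    and F: "F = (\<lambda>z. J * (a * v z - \<beta> / K * q z))"
    and hA: "hA = (\<lambda>s. J * (a * wA s - \<beta> / K * face_trace A q s + sA * (face_trace A v s - wA s)))"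
    and hB: "hB = (\<lambda>s. J * (- a * wB s + \<beta> / K * face_trace B q s + sB * (face_trace B v s - wB s)))"
    and R: "R = (\<lambda>z. D F z + (lift p c A (\<lambda>s. hA s - face_trace A F s) z + lift p c B (\<lambda>s. hB s + face_trace B F s) z))"
  shows "R \<in> Q_space p"
    and "vcjh_ip p c hA wA + vcjh_ip p c hB wB - J * a / 2 * (vcjh_ip p c wA wA - vcjh_ip p c wB wB) \<le> sobolev_ip p c R v"
proof -
  note PQ = P_space_add P_space_diff P_space_scale face_trace_P_space Q_space_add Q_space_diff Q_space_scale
    lift_Q_space D_Q v wA wB
  have dA: "(\<lambda>s. wA s - face_trace A v s) \<in> P_space p" and dB: "(\<lambda>s. wB s - face_trace B v s) \<in> P_space p"
    by (intro PQ)+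
  have qQ: "q \<in> Q_space p" unfolding q by (intro PQ)
  have FQ: "F \<in> Q_space p" unfolding F by (intro PQ qQ)
  have hAP: "hA \<in> P_space p" and hBP: "hB \<in> P_space p" unfolding hA hB by (intro PQ qQ)+
  have hFA: "(\<lambda>s. hA s - face_trace A F s) \<in> P_space p" and hFB: "(\<lambda>s. hB s + face_trace B F s) \<in> P_space p"
    by (intro PQ hAP hBP FQ)+
  show "R \<in> Q_space p" unfolding R by (intro PQ FQ hFA hFB)
  note tv = face_trace_P_space[OF v] and tq = face_trace_P_space[OF qQ] and tF = face_trace_P_space[OF FQ]
  have "sobolev_ip p c R v = sobolev_ip p c (D F) v + (vcjh_ip p c (\<lambda>s. hA s - face_trace A F s) (face_trace A v)
      + vcjh_ip p c (\<lambda>s. hB s + face_trace B F s) (face_trace B v))"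
    unfolding R by (simp add: sobolev_ip_add_left v D_Q FQ lift_Q_space hFA hFB Q_space_add
        sobolev_ip_lift[OF p c hFA v] sobolev_ip_lift[OF p c hFB v])
  \<comment> \<open>Integration by parts produces the traces of F, which cancel those in the lifted
    defects; only the common fluxes remain on the faces.\<close>
  also have "\<dots> = vcjh_ip p c hA (face_trace A v) + vcjh_ip p c hB (face_trace B v) - sobolev_ip p c F (D v)"
    using by_parts[OF FQ v] by (simp add: vcjh_ip_diff_left vcjh_ip_add_left tv tF hAP hBP)
  finally have R_v: "sobolev_ip p c R v = vcjh_ip p c hA (face_trace A v) + vcjh_ip p c hB (face_trace B v) - sobolev_ip p c F (D v)" .
  have F_Dv: "sobolev_ip p c F (D v) = J * (a * sobolev_ip p c v (D v) - \<beta> / K * sobolev_ip p c q (D v))"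
    unfolding F by (simp only: sobolev_ip_scale_left sobolev_ip_diff_left Q_space_diff Q_space_scale v qQ D_Q)
  \<comment> \<open>Solving the gradient equation for the derivative of v makes the square of q
    appear when it is paired with q.\<close>
  have Dv: "D v = (\<lambda>z. q z - (lift p c A (\<lambda>s. wA s - face_trace A v s) z - lift p c B (\<lambda>s. wB s - face_trace B v s) z))"
    by (simp add: q)
  have q_Dv: "sobolev_ip p c q (D v) = sobolev_ip p c q q
      - (vcjh_ip p c (face_trace A q) (\<lambda>s. wA s - face_trace A v s) - vcjh_ip p c (face_trace B q) (\<lambda>s. wB s - face_trace B v s))"
    unfolding Dv by (simp add: sobolev_ip_diff_right lift_Q_space dA dB qQ Q_space_diff
        sobolev_ip_commute[of p c q "lift _ _ _ _"] sobolev_ip_lift[OF p c dA qQ] sobolev_ip_lift[OF p c dB qQ] vcjh_ip_commute[of p c "face_trace _ q"])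
  have v_Dv: "sobolev_ip p c v (D v) = (vcjh_ip p c (face_trace A v) (face_trace A v) - vcjh_ip p c (face_trace B v) (face_trace B v)) / 2"
    using by_parts[OF v v] by (simp add: sobolev_ip_commute[of p c "D v"])
  have hA_y: "vcjh_ip p c hA y = J * (a * vcjh_ip p c wA y - \<beta> / K * vcjh_ip p c (face_trace A q) y
      + sA * (vcjh_ip p c (face_trace A v) y - vcjh_ip p c wA y))" if "y \<in> P_space p" for y
    unfolding hA by (simp only: vcjh_ip_scale_left vcjh_ip_diff_left vcjh_ip_add_left P_space_scale P_space_diff
      P_space_add wA tv tq that)
  have hB_y: "vcjh_ip p c hB y = J * (- a * vcjh_ip p c wB y + \<beta> / K * vcjh_ip p c (face_trace B q) y
      + sB * (vcjh_ip p c (face_trace B v) y - vcjh_ip p c wB y))" if "y \<in> P_space p" for y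
    unfolding hB by (simp only: vcjh_ip_scale_left vcjh_ip_diff_left vcjh_ip_add_left P_space_scale P_space_diff
      P_space_add wB tv tq that)
  have sq: "vcjh_ip p c (\<lambda>s. face_trace f v s - w s) (\<lambda>s. face_trace f v s - w s)
      = vcjh_ip p c (face_trace f v) (face_trace f v) - 2 * vcjh_ip p c (face_trace f v) w + vcjh_ip p c w w"
    if "w \<in> P_space p" for f w
    using that by (simp add: vcjh_ip_diff_left vcjh_ip_diff_right tv P_space_diff vcjh_ip_commute[of p c w "face_trace f v"])
  have pos: "0 \<le> vcjh_ip p c (\<lambda>s. face_trace f v s - w s) (\<lambda>s. face_trace f v s - w s)" if "w \<in> P_space p" for f w
    using that c by (intro vcjh_ip_nonneg P_space_diff tv)
  have "sobolev_ip p c R v - (vcjh_ip p c hA wA + vcjh_ip p c hB wB - J * a / 2 * (vcjh_ip p c wA wA - vcjh_ip p c wB wB))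
      = J * ((sA - a / 2) * vcjh_ip p c (\<lambda>s. face_trace A v s - wA s) (\<lambda>s. face_trace A v s - wA s)
        + (sB + a / 2) * vcjh_ip p c (\<lambda>s. face_trace B v s - wB s) (\<lambda>s. face_trace B v s - wB s)
        + \<beta> / K * sobolev_ip p c q q)"
    unfolding R_v F_Dv q_Dv v_Dv hA_y[OF wA] hB_y[OF wB] hA_y[OF tv] hB_y[OF tv] sq[OF wA] sq[OF wB]
      vcjh_ip_diff_right[OF wA tv tq] vcjh_ip_diff_right[OF wB tv tq] vcjh_ip_commute[of p c wA "face_trace A v"]
      vcjh_ip_commute[of p c wB "face_trace B v"]
    by (rule completed_square)
  also have "\<dots> \<ge> 0"
  proof -
    have sgn: "0 \<le> sA - a / 2" "0 \<le> sB + a / 2" "0 \<le> J" "0 \<le> \<beta> / K" using sA sB J K \<beta> by auto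
    show ?thesis
      using sgn(1,2) pos[OF wA] pos[OF wB] sobolev_ip_nonneg[OF qQ c]
      by (intro mult_nonneg_nonneg[OF sgn(3)] add_nonneg_nonneg
          mult_nonneg_nonneg[OF sgn(1)] mult_nonneg_nonneg[OF sgn(2)] mult_nonneg_nonneg[OF sgn(4)])
  qed
  finally show "vcjh_ip p c hA wA + vcjh_ip p c hB wB - J * a / 2 * (vcjh_ip p c wA wA - vcjh_ip p c wB wB)
      \<le> sobolev_ip p c R v" by simp
qed

text \<open>Each pair of opposite faces corrects one component only. The minus signs are the outward
  normals at -1.\<close>

lemma q_ref_eq:
  assumes v: "u k \<in> Q_space p" and w: "\<And>f. uh (the_face G (k, f)) \<in> P_space p"
    and X: "flux_points p X"
  defines "\<delta> \<equiv> \<lambda>f s. uh (the_face G (k, f)) s - face_trace f (u k) s"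
  shows "q_ref G p c X u uh k z =
    (d_xi (u k) z + (lift p c East (\<delta> East) z - lift p c West (\<delta> West) z),
     d_eta (u k) z + (lift p c North (\<delta> North) z - lift p c South (\<delta> South) z))"
proof -
  have "\<delta> f \<in> P_space p" for f unfolding \<delta>_def by (intro P_space_diff w face_trace_P_space v)
  from sum_divg_corr[OF this X]
  have "(\<Sum>m\<in>{1..p + 1}. (divg (corr p c X f m) z
        * (uh (the_face G (k, f)) (X f m) - u k (ref_pt f (X f m)))) *\<^sub>R normal f)
      = lift p c f (\<delta> f) z *\<^sub>R normal f" for f
    by (simp add: \<delta>_def face_trace_def flip: scaleR_sum_left del: sum.cl_ivl_Suc)
  then show ?thesis
    unfolding q_ref_def grad_def by (simp only:) (simp add: UNIV_side)
qed

lemma common_flux_P_space: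
  assumes v: "u k \<in> Q_space p" and w: "\<And>f. uh (the_face G (k, f)) \<in> P_space p"
    and X: "flux_points p X"
  shows "(\<lambda>s. common_flux G p c \<alpha> \<beta> X stab u uh (k, f) s \<bullet> normal f) \<in> P_space p"
proof -
  note PQ = P_space_add P_space_diff P_space_scale face_trace_P_space Q_space_add Q_space_diff Q_space_scale
    lift_Q_space d_Q_space v w
  have Q: "(\<lambda>z. fst (q_ref G p c X u uh k z)) \<in> Q_space p"
    "(\<lambda>z. snd (q_ref G p c X u uh k z)) \<in> Q_space p"
    unfolding q_ref_eq[where u = u and k = k and uh = uh and G = G, OF v w X] fst_conv snd_conv by (intro PQ)+
  have "(\<lambda>s. common_flux G p c \<alpha> \<beta> X stab u uh (k, f) s \<bullet> normal f)
      = (\<lambda>s. (\<alpha> \<bullet> normal f) * uh (the_face G (k, f)) s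
         - ((\<beta> / Jx G k * fst (normal f)) * face_trace f (\<lambda>z. fst (q_ref G p c X u uh k z)) s
           + (\<beta> / Jy G k * snd (normal f)) * face_trace f (\<lambda>z. snd (q_ref G p c X u uh k z)) s)
         + (stab (k, f) * (normal f \<bullet> normal f)) * (face_trace f (u k) s - uh (the_face G (k, f)) s))"
    by (auto simp: fun_eq_iff common_flux_def q_phys_def inner_prod_def face_trace_def algebra_simps add_divide_distrib)
  then show ?thesis by (simp only:) (intro PQ Q)
qed

text \<open>On an axis-parallel element the scheme splits into two directional residuals, one per
  component of flux and gradient, and \<open>directional_energy\<close> bounds each.\<close>

lemma element_energy:
  assumes p: "p \<ge> 1" and c: "c \<ge> 0" and \<beta>: "\<beta> \<ge> 0" and J: "Jx G k > 0" "Jy G k > 0"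
    and v: "u k \<in> Q_space p" and w: "\<And>f. uh (the_face G (k, f)) \<in> P_space p"
    and X: "flux_points p X"
    and stab: "\<And>f. stab (k, f) > (\<alpha> \<bullet> normal f) / 2"
    and v': "v' \<in> Q_space p"
    and scheme: "\<And>z. z \<in> cbox (-1, -1) (1, 1) \<Longrightarrow>
      v' z + 1 / Jdet G k * divg (flux_ref G p c \<alpha> \<beta> X u uh k) z
       + 1 / Jdet G k * (\<Sum>f\<in>UNIV. \<Sum>m\<in>{1..p + 1}. divg (corr p c X f m) z *
               flux_defect G p c \<alpha> \<beta> X stab u uh (k, f) (X f m)) = 0"
  shows "Jdet G k * sobolev_ip p c v' (u k) \<le> (\<Sum>f\<in>UNIV. Jface G (k, f) *
     ((\<alpha> \<bullet> normal f) / 2 * vcjh_ip p c (uh (the_face G (k, f))) (uh (the_face G (k, f)))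
      - vcjh_ip p c (\<lambda>s. common_flux G p c \<alpha> \<beta> X stab u uh (k, f) s \<bullet> normal f) (uh (the_face G (k, f)))))"
proof -
  obtain a1 a2 where \<alpha>: "\<alpha> = (a1, a2)" by (cases \<alpha>)
  define W where "W = (\<lambda>f. uh (the_face G (k, f)))"
  define q1 where "q1 = (\<lambda>z. fst (q_ref G p c X u uh k z))"
  define q2 where "q2 = (\<lambda>z. snd (q_ref G p c X u uh k z))"
  \<comment> \<open>Since \<open>Jdet\<close> / \<open>Jx\<close> = \<open>Jy\<close>, the first
    contravariant component carries the Jacobian of the faces that it crosses.\<close>
  define F1 where "F1 = (\<lambda>z. Jy G k * (a1 * u k z - \<beta> / Jx G k * q1 z))"
  define F2 where "F2 = (\<lambda>z. Jx G k * (a2 * u k z - \<beta> / Jy G k * q2 z))"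
  define h where "h = (\<lambda>f s. Jface G (k, f) * (common_flux G p c \<alpha> \<beta> X stab u uh (k, f) s \<bullet> normal f))"
  define R1 where "R1 = (\<lambda>z. d_xi F1 z + (lift p c East (\<lambda>s. h East s - face_trace East F1 s) z
      + lift p c West (\<lambda>s. h West s + face_trace West F1 s) z))"
  define R2 where "R2 = (\<lambda>z. d_eta F2 z + (lift p c North (\<lambda>s. h North s - face_trace North F2 s) z
      + lift p c South (\<lambda>s. h South s + face_trace South F2 s) z))"
  have WP: "W f \<in> P_space p" for f unfolding W_def by (rule w)
  have q1: "q1 = (\<lambda>z. d_xi (u k) z + (lift p c East (\<lambda>s. W East s - face_trace East (u k) s) z
      - lift p c West (\<lambda>s. W West s - face_trace West (u k) s) z))"
    and q2: "q2 = (\<lambda>z. d_eta (u k) z + (lift p c North (\<lambda>s. W North s - face_trace North (u k) s) z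
      - lift p c South (\<lambda>s. W South s - face_trace South (u k) s) z))"
    unfolding q1_def q2_def q_ref_eq[where u = u and k = k and uh = uh and G = G, OF v w X] W_def by simp_all
  have hE: "h East = (\<lambda>s. Jy G k * (a1 * W East s - \<beta> / Jx G k * face_trace East q1 s
      + stab (k, East) * (face_trace East (u k) s - W East s)))"
    and hW: "h West = (\<lambda>s. Jy G k * (- a1 * W West s + \<beta> / Jx G k * face_trace West q1 s
      + stab (k, West) * (face_trace West (u k) s - W West s)))"
    and hN: "h North = (\<lambda>s. Jx G k * (a2 * W North s - \<beta> / Jy G k * face_trace North q2 s
      + stab (k, North) * (face_trace North (u k) s - W North s)))"
    and hS: "h South = (\<lambda>s. Jx G k * (- a2 * W South s + \<beta> / Jy G k * face_trace South q2 s
      + stab (k, South) * (face_trace South (u k) s - W South s)))"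
    by (simp_all add: h_def common_flux_def q_phys_def inner_prod_def \<alpha> W_def q1_def q2_def face_trace_def fun_eq_iff)
  have flux_ref: "flux_ref G p c \<alpha> \<beta> X u uh k z = (F1 z, F2 z)" for z
    using J by (simp add: flux_ref_def flux_def q_phys_def Jdet_def \<alpha> F1_def F2_def q1_def q2_def mult_ac)
  have defect: "flux_defect G p c \<alpha> \<beta> X stab u uh (k, f) s
      = h f s - (F1 (ref_pt f s), F2 (ref_pt f s)) \<bullet> normal f" for f s
    by (simp add: flux_defect_def h_def flux_ref)
  note st = stab[unfolded \<alpha>]
  note R1 = directional_energy[where D = d_xi and A = East and B = West and v = "u k"
      and wA = "W East" and wB = "W West" and a = a1 and sA = "stab (k, East)" and sB = "stab (k, West)",
      OF p c \<beta> J(2) J(1) d_Q_space(1) sobolev_ip_by_parts(1) v WP WP _ _ q1 F1_def hE hW R1_def]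
  note R2 = directional_energy[where D = d_eta and A = North and B = South and v = "u k"
      and wA = "W North" and wB = "W South" and a = a2 and sA = "stab (k, North)" and sB = "stab (k, South)",
      OF p c \<beta> J(1) J(2) d_Q_space(2) sobolev_ip_by_parts(2) v WP WP _ _ q2 F2_def hN hS R2_def]
  have R1Q: "R1 \<in> Q_space p"
    and R1v: "vcjh_ip p c (h East) (W East) + vcjh_ip p c (h West) (W West)
      - Jy G k * a1 / 2 * (vcjh_ip p c (W East) (W East) - vcjh_ip p c (W West) (W West)) \<le> sobolev_ip p c R1 (u k)"
    using R1 st[of East] st[of West] by (simp_all add: inner_prod_def)
  have R2Q: "R2 \<in> Q_space p"
    and R2v: "vcjh_ip p c (h North) (W North) + vcjh_ip p c (h South) (W South)
      - Jx G k * a2 / 2 * (vcjh_ip p c (W North) (W North) - vcjh_ip p c (W South) (W South)) \<le> sobolev_ip p c R2 (u k)"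
    using R2 st[of North] st[of South] by (simp_all add: inner_prod_def)
  note PQ = P_space_add P_space_diff P_space_scale face_trace_P_space Q_space_add Q_space_diff Q_space_scale
    lift_Q_space d_Q_space v WP
  have hP: "h f \<in> P_space p" for f
    unfolding h_def by (intro P_space_scale common_flux_P_space v w X)
  have q1Q: "q1 \<in> Q_space p" and q2Q: "q2 \<in> Q_space p" unfolding q1 q2 by (intro PQ)+
  have FQ: "F1 \<in> Q_space p" "F2 \<in> Q_space p" unfolding F1_def F2_def by (intro PQ q1Q q2Q)+
  have defectP: "flux_defect G p c \<alpha> \<beta> X stab u uh (k, f) \<in> P_space p" for f
  proof -
    have "flux_defect G p c \<alpha> \<beta> X stab u uh (k, f)
        = (\<lambda>s. h f s - (fst (normal f) * face_trace f F1 s + snd (normal f) * face_trace f F2 s))"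
      by (simp add: fun_eq_iff defect inner_prod_def face_trace_def mult.commute)
    then show ?thesis by (simp only:) (intro PQ hP FQ)
  qed
  have residual: "divg (flux_ref G p c \<alpha> \<beta> X u uh k) z + (\<Sum>f\<in>UNIV. \<Sum>m\<in>{1..p + 1}. divg (corr p c X f m) z *
               flux_defect G p c \<alpha> \<beta> X stab u uh (k, f) (X f m)) = R1 z + R2 z" for z
  proof -
    have "flux_defect G p c \<alpha> \<beta> X stab u uh (k, East) = (\<lambda>s. h East s - face_trace East F1 s)"
      "flux_defect G p c \<alpha> \<beta> X stab u uh (k, West) = (\<lambda>s. h West s + face_trace West F1 s)"
      "flux_defect G p c \<alpha> \<beta> X stab u uh (k, North) = (\<lambda>s. h North s - face_trace North F2 s)"
      "flux_defect G p c \<alpha> \<beta> X stab u uh (k, South) = (\<lambda>s. h South s + face_trace South F2 s)"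
      by (simp_all add: fun_eq_iff defect inner_prod_def face_trace_def)
    then show ?thesis
      by (simp only: sum_divg_corr[OF defectP X]) (simp add: divg_def[of "flux_ref _ _ _ _ _ _ _ _ _"] flux_ref
        UNIV_side R1_def R2_def del: sum.cl_ivl_Suc)
  qed
  have Jd: "Jdet G k > 0" using J by (simp add: Jdet_def)
  \<comment> \<open>The scheme constrains the square only; both sides are polynomials, so they are
    equal as functions and can be paired with the solution.\<close>
  have "v' = (\<lambda>z. - (1 / Jdet G k) * (R1 z + R2 z))"
  proof (rule Q_space_eqI[OF v' _ X])
    show "(\<lambda>z. - (1 / Jdet G k) * (R1 z + R2 z)) \<in> Q_space p"
      by (intro PQ R1Q R2Q)
    fix z :: "real \<times> real"
    assume z: "z \<in> cbox (-1, -1) (1, 1)"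
    have *: "x = - i * (a + b)" if "x + i * a + i * b = 0" for x i a b :: real
      using that by (simp add: distrib_left)
    show "v' z = - (1 / Jdet G k) * (R1 z + R2 z)"
      unfolding residual[symmetric] by (rule *[OF scheme[OF z]])
  qed
  then have "Jdet G k * sobolev_ip p c v' (u k) = - (sobolev_ip p c R1 (u k) + sobolev_ip p c R2 (u k))"
    using Jd by (simp only: sobolev_ip_scale_left sobolev_ip_add_left Q_space_add R1Q R2Q v) simp
  moreover have "vcjh_ip p c (h f) (W f) = Jface G (k, f)
      * vcjh_ip p c (\<lambda>s. common_flux G p c \<alpha> \<beta> X stab u uh (k, f) s \<bullet> normal f) (W f)" for f
    unfolding h_def by (intro vcjh_ip_scale_left common_flux_P_space v w X)
  ultimately show ?thesis
    using R1v R2v unfolding W_def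
    by (simp add: UNIV_side \<alpha> inner_prod_def algebra_simps)
qed

section \<open>Faces of the grid\<close>

lemma period_add: "period G m n + period G m' n' = period G (m + m') (n + n')"
  by (simp add: period_def algebra_simps)

lemma period_minus: "- period G m n = period G (- m) (- n)"
  by (simp add: period_def)

lemma same_face_refl: "same_face G \<sigma> \<sigma>"
proof -
  have "period G 0 0 = 0" by (simp add: period_def zero_prod_def)
  then show ?thesis unfolding same_face_def by (intro exI[of _ 0]) simp
qed

lemma same_face_sym:
  assumes "same_face G \<sigma> \<tau>"
  shows "same_face G \<tau> \<sigma>"
proof -
  obtain m n where "\<forall>s\<in>{-1..1}. side_pt G \<sigma> s = side_pt G \<tau> s + period G m n"
    using assms unfolding same_face_def by blast
  then have "\<forall>s\<in>{-1..1}. side_pt G \<tau> s = side_pt G \<sigma> s + period G (- m) (- n)"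
    by (simp flip: period_minus)
  then show ?thesis unfolding same_face_def by blast
qed

lemma same_face_trans:
  assumes "same_face G \<sigma> \<tau>" "same_face G \<tau> \<rho>"
  shows "same_face G \<sigma> \<rho>"
proof -
  obtain m n m' n' where "\<forall>s\<in>{-1..1}. side_pt G \<sigma> s = side_pt G \<tau> s + period G m n"
    "\<forall>s\<in>{-1..1}. side_pt G \<tau> s = side_pt G \<rho> s + period G m' n'"
    using assms unfolding same_face_def by blast
  then have "\<forall>s\<in>{-1..1}. side_pt G \<sigma> s = side_pt G \<rho> s + period G (m' + m) (n' + n)"
    by (simp flip: period_add add: add.assoc)
  then show ?thesis unfolding same_face_def by blast
qed

lemma the_face_eq: "\<tau> \<in> the_face G \<sigma> \<Longrightarrow> the_face G \<tau> = the_face G \<sigma>"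
  unfolding the_face_def using same_face_sym same_face_trans by blast

lemma face_eq: "F \<in> faces G \<Longrightarrow> \<sigma> \<in> F \<Longrightarrow> the_face G \<sigma> = F"
  unfolding faces_def using the_face_eq by blast

lemma face_subset_sides: "F \<in> faces G \<Longrightarrow> F \<subseteq> sides G"
  by (auto simp: faces_def the_face_def)

lemma finite_sides: "finite (sides G)"
  by (simp add: sides_def)

lemma finite_faces: "finite (faces G)"
  by (simp add: faces_def finite_sides)

text \<open>Faces are the classes of an equivalence relation on the element sides, so they partition
  them.\<close>

lemma sum_sides_faces: "(\<Sum>\<sigma>\<in>sides G. g \<sigma>) = (\<Sum>F\<in>faces G. \<Sum>\<sigma>\<in>F. g \<sigma>)"
  for g :: "nat \<times> side \<Rightarrow> real"
proof -
  have "\<Union>(faces G) = sides G"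
    using face_subset_sides same_face_refl by (auto simp: faces_def the_face_def)
  moreover have "sum g (\<Union>(faces G)) = (\<Sum>F\<in>faces G. \<Sum>\<sigma>\<in>F. g \<sigma>)"
  proof (subst sum.Union_disjoint)
    show "\<forall>F\<in>faces G. finite F" using face_subset_sides finite_sides finite_subset by blast
    show "\<forall>A\<in>faces G. \<forall>B\<in>faces G. A \<noteq> B \<longrightarrow> A \<inter> B = {}" using face_eq by blast
  qed simp
  ultimately show ?thesis by simp
qed

lemma grid_J_pos:
  assumes "cartesian_grid G" "k < num_elems G"
  shows "Jx G k > 0" "Jy G k > 0"
  using assms by (auto simp: cartesian_grid_def Jx_def Jy_def)

lemma grid_Jface_pos:
  assumes "cartesian_grid G" "\<sigma> \<in> sides G"
  shows "Jface G \<sigma> > 0"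
proof -
  obtain k f where "\<sigma> = (k, f)" by (cases \<sigma>)
  then show ?thesis using assms grid_J_pos by (cases f) (auto simp: sides_def)
qed

text \<open>Differences of points on a side forget the period. The difference between parameters 1
  and 0 is tangential, of length the face Jacobian, and opposite normals make the two sides
  parallel.\<close>

lemma same_face_Jface:
  assumes "same_face G \<sigma> \<tau>" "normal (snd \<tau>) = - normal (snd \<sigma>)"
  shows "Jface G \<sigma> = Jface G \<tau>"
proof -
  obtain m n where "\<forall>s\<in>{-1..1}. side_pt G \<sigma> s = side_pt G \<tau> s + period G m n"
    using assms unfolding same_face_def by blast
  then have "side_pt G \<sigma> 1 - side_pt G \<sigma> 0 = side_pt G \<tau> 1 - side_pt G \<tau> 0" by simp
  moreover obtain k f l g where "\<sigma> = (k, f)" "\<tau> = (l, g)" by (cases \<sigma>, cases \<tau>)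
  ultimately show ?thesis
    using assms(2) by (cases f; cases g) (auto simp: side_pt_def to_phys_def)
qed

lemma faceE:
  assumes "cartesian_grid G" "F \<in> faces G"
  obtains \<sigma> \<tau> where "\<sigma> \<noteq> \<tau>" "F = {\<sigma>, \<tau>}" "normal (snd \<tau>) = - normal (snd \<sigma>)"
    "Jface G \<sigma> = Jface G \<tau>" "Jface G \<sigma> > 0"
proof -
  obtain \<sigma> where \<sigma>: "\<sigma> \<in> sides G" "F = the_face G \<sigma>" using assms(2) by (auto simp: faces_def)
  then obtain \<tau> where \<tau>: "\<tau> \<noteq> \<sigma>" "the_face G \<sigma> = {\<sigma>, \<tau>}" "normal (snd \<tau>) = - normal (snd \<sigma>)"
    using assms(1) unfolding cartesian_grid_def conforming_def by blast
  then have "same_face G \<sigma> \<tau>" by (auto simp: the_face_def)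
  then show thesis
    using that[of \<sigma> \<tau>] \<sigma> \<tau> same_face_Jface grid_Jface_pos[OF assms(1)] by metis
qed

lemma face_integral_eq:
  assumes "cartesian_grid G" "F \<in> faces G" "\<sigma> \<in> F"
  shows "face_integral G F \<phi> = Jface G \<sigma> * integral {-1..1} \<phi>"
proof -
  obtain \<rho> \<tau> where "F = {\<rho>, \<tau>}" "Jface G \<rho> = Jface G \<tau>" using faceE[OF assms(1,2)] by metis
  then have "(THE J. \<forall>\<sigma>\<in>F. Jface G \<sigma> = J) = Jface G \<sigma>"
    using assms(3) by (intro the_equality) auto
  then show ?thesis by (simp add: face_integral_def)
qed

section \<open>The transmission conditions\<close>

lemma trace_space_P_space:
  "uh \<in> trace_space G p kind \<Longrightarrow> F \<in> faces G \<Longrightarrow> uh F \<in> P_space p"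
  by (cases kind) (auto simp: M_space_def)

lemma common_flux_side_P_space:
  assumes "flux_points p X" "\<And>k. k < num_elems G \<Longrightarrow> u k \<in> Q_space p" "uh \<in> trace_space G p kind"
    and "\<sigma> \<in> sides G"
  shows "(\<lambda>s. common_flux G p c \<alpha> \<beta> X stab u uh \<sigma> s \<bullet> normal (snd \<sigma>)) \<in> P_space p"
proof -
  obtain k f where \<sigma>: "\<sigma> = (k, f)" by (cases \<sigma>)
  then have k: "k < num_elems G" using assms(4) by (auto simp: sides_def)
  then have "uh (the_face G (k, g)) \<in> P_space p" for g
    by (intro trace_space_P_space[OF assms(3)]) (auto simp: faces_def sides_def)
  then show ?thesis
    using common_flux_P_space[where u = u and k = k and uh = uh and G = G, OF assms(2)[OF k] _ assms(1)] \<sigma>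
    by simp
qed

text \<open>This passes from the L2 condition to the pairing of the element balances. The weight
  \<open>face_integral G F (\<lambda>s. 1)\<close> is twice the face Jacobian, without a chosen
  side.\<close>

lemma vcjh_ip_flux_jump_sum:
  assumes grid: "cartesian_grid G" and X: "flux_points p X"
    and u: "\<And>k. k < num_elems G \<Longrightarrow> u k \<in> Q_space p"
    and uh: "uh \<in> trace_space G p kind"
    and discrete: "discrete_transmission G p c \<alpha> \<beta> X stab kind u uh"
    and pointwise: "kind = EFR \<Longrightarrow> c \<noteq> 0 \<Longrightarrow> pointwise_transmission G p c \<alpha> \<beta> X stab u uh"
  shows "(\<Sum>F\<in>faces G. face_integral G F (\<lambda>s. 1) * vcjh_ip p c (flux_jump G p c \<alpha> \<beta> X stab u uh F) (uh F)) = 0"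
proof -
  define j where "j = flux_jump G p c \<alpha> \<beta> X stab u uh"
  have P: "j F \<in> P_space p" if F: "F \<in> faces G" for F
    unfolding j_def flux_jump_def[abs_def] using face_subset_sides[OF F]
    by (intro P_space_sum common_flux_side_P_space[OF X u uh]) auto
  consider "c = 0" | "c \<noteq> 0" "kind = HFR" | "c \<noteq> 0" "kind = EFR" by (cases kind) auto
  then show ?thesis
  proof cases
    case 1
    have "face_integral G F (\<lambda>s. 1) * vcjh_ip p c (j F) (uh F) = 2 * face_integral G F (\<lambda>s. j F s * uh F s)" for F
      by (simp add: 1 face_integral_def vcjh_ip_def)
    then show ?thesis
      using discrete uh unfolding discrete_transmission_def j_def[symmetric]
      by (simp flip: sum_distrib_left)
  next
    case 2
    \<comment> \<open>The jump is its own test function: a vanishing sum of nonnegative integrals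
      makes it zero on every face.\<close>
    have "j \<in> trace_space G p kind" using P 2 by (simp add: M_space_def)
    then have "(\<Sum>F\<in>faces G. face_integral G F (\<lambda>s. j F s * j F s)) = 0"
      using discrete unfolding discrete_transmission_def j_def by blast
    moreover have "face_integral G F (\<lambda>s. j F s * j F s) \<ge> 0" if F: "F \<in> faces G" for F
    proof -
      obtain \<sigma> where "\<sigma> \<in> F" "Jface G \<sigma> > 0" using faceE[OF grid F] by blast
      moreover have "integral {-1..1} (\<lambda>s. j F s * j F s) \<ge> 0"
        by (intro integral_nonneg integrable_continuous_real continuous_intros continuous_on_P_space[OF P[OF F]]) auto
      ultimately show ?thesis by (simp add: face_integral_eq[OF grid F])
    qed
    ultimately have z: "face_integral G F (\<lambda>s. j F s * j F s) = 0" if "F \<in> faces G" for F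
      using that by (simp add: sum_nonneg_eq_0_iff finite_faces)
    have "j F = (\<lambda>s. 0)" if F: "F \<in> faces G" for F
    proof (rule P_space_zeroI[OF P[OF F]])
      fix x :: real assume x: "x \<in> {-1..1}"
      obtain \<sigma> where "\<sigma> \<in> F" "Jface G \<sigma> > 0" using faceE[OF grid F] by blast
      then have "integral {-1..1} (\<lambda>s. j F s * j F s) = 0"
        using z[OF F] by (simp add: face_integral_eq[OF grid F])
      moreover have "continuous_on {-1..1} (\<lambda>s. j F s * j F s)"
        by (intro continuous_intros continuous_on_P_space[OF P[OF F]])
      ultimately have "j F x * j F x = 0"
        using integral_eq_0_iff[of "-1" 1 "\<lambda>s. j F s * j F s"] x by auto
      then show "j F x = 0" by simp
    qed
    then show ?thesis by (simp add: vcjh_ip_zero_left flip: j_def)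
  next
    case 3
    then have "j F x = 0" if "F \<in> faces G" "x \<in> {-1..1}" for F x
      using pointwise that unfolding pointwise_transmission_def j_def by blast
    then have "j F = (\<lambda>s. 0)" if "F \<in> faces G" for F
      using that by (intro P_space_zeroI[OF P])
    then show ?thesis by (simp add: vcjh_ip_zero_left flip: j_def)
  qed
qed

text \<open>On each face the two values of \<open>\<alpha> \<bullet> normal\<close> cancel.\<close>

lemma boundary_sum_eq_0:
  assumes grid: "cartesian_grid G" and X: "flux_points p X"
    and u: "\<And>k. k < num_elems G \<Longrightarrow> u k \<in> Q_space p"
    and uh: "uh \<in> trace_space G p kind"
    and discrete: "discrete_transmission G p c \<alpha> \<beta> X stab kind u uh"
    and pointwise: "kind = EFR \<Longrightarrow> c \<noteq> 0 \<Longrightarrow> pointwise_transmission G p c \<alpha> \<beta> X stab u uh"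
  shows "(\<Sum>\<sigma>\<in>sides G. Jface G \<sigma> *
     ((\<alpha> \<bullet> normal (snd \<sigma>)) / 2 * vcjh_ip p c (uh (the_face G \<sigma>)) (uh (the_face G \<sigma>))
      - vcjh_ip p c (\<lambda>s. common_flux G p c \<alpha> \<beta> X stab u uh \<sigma> s \<bullet> normal (snd \<sigma>)) (uh (the_face G \<sigma>)))) = 0"
    (is "(\<Sum>\<sigma>\<in>sides G. ?B \<sigma>) = 0")
proof -
  define j where "j = flux_jump G p c \<alpha> \<beta> X stab u uh"
  \<comment> \<open>The factor 1/2 compensates the length 2 of the reference interval.\<close>
  have "(\<Sum>\<sigma>\<in>F. ?B \<sigma>) = - (1 / 2) * (face_integral G F (\<lambda>s. 1) * vcjh_ip p c (j F) (uh F))"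
    if F: "F \<in> faces G" for F
  proof -
    obtain \<sigma> \<tau> where st: "\<sigma> \<noteq> \<tau>" "F = {\<sigma>, \<tau>}" "normal (snd \<tau>) = - normal (snd \<sigma>)"
      and J: "Jface G \<sigma> = Jface G \<tau>"
      using faceE[OF grid F] by metis
    define h where "h \<sigma> s = common_flux G p c \<alpha> \<beta> X stab u uh \<sigma> s \<bullet> normal (snd \<sigma>)" for \<sigma> s
    have h: "h \<rho> \<in> P_space p" if "\<rho> \<in> F" for \<rho>
      using common_flux_side_P_space[where u = u, OF X u uh] face_subset_sides[OF F] that
      unfolding h_def[abs_def] by blast
    have "j F = (\<lambda>s. h \<sigma> s + h \<tau> s)"
      using st by (simp add: j_def flux_jump_def[abs_def] h_def)
    then have "vcjh_ip p c (j F) (uh F) = vcjh_ip p c (h \<sigma>) (uh F) + vcjh_ip p c (h \<tau>) (uh F)"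
      using h st trace_space_P_space[OF uh F] by (simp add: vcjh_ip_add_left)
    moreover have "the_face G \<sigma> = F" "the_face G \<tau> = F" using face_eq[OF F] st by auto
    moreover have "face_integral G F (\<lambda>s. 1) = 2 * Jface G \<sigma>"
      using face_integral_eq[OF grid F, of \<sigma> "\<lambda>s. 1"] st by simp
    ultimately show ?thesis
      using st J by (simp add: h_def[symmetric, abs_def] algebra_simps)
  qed
  then have "(\<Sum>\<sigma>\<in>sides G. ?B \<sigma>)
      = - (1 / 2) * (\<Sum>F\<in>faces G. face_integral G F (\<lambda>s. 1) * vcjh_ip p c (j F) (uh F))"
    by (simp add: sum_sides_faces sum_distrib_left)
  then show ?thesis
    using vcjh_ip_flux_jump_sum[OF assms] by (simp add: j_def)
qed

section \<open>The broken norm\<close>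

lemma integral_affine:
  fixes a b :: real and h :: "real \<Rightarrow> real"
  assumes "a < b" "h integrable_on {-1..1}"
  shows "integral {a..b} (\<lambda>x. h ((x - (a + b) / 2) / ((b - a) / 2))) = (b - a) / 2 * integral {-1..1} h"
proof -
  define J where "J = (b - a) / 2"
  have J: "J > 0" using assms(1) by (simp add: J_def)
  have "((\<lambda>x. h ((1 / J) *\<^sub>R x + - ((a + b) / 2 / J))) has_integral
      (1 / (\<bar>1 / J\<bar> ^ DIM(real))) *\<^sub>R integral {-1..1} h)
      ((\<lambda>x. (1 / (1 / J)) *\<^sub>R x + - ((1 / (1 / J)) *\<^sub>R - ((a + b) / 2 / J))) ` cbox (-1) 1)"
    using assms(2) J by (intro has_integral_affinity) (auto intro: integrable_integral)
  moreover have "(\<lambda>x. (1 / (1 / J)) *\<^sub>R x + - ((1 / (1 / J)) *\<^sub>R - ((a + b) / 2 / J))) ` cbox (-1) 1 = {a..b}"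
  proof -
    have "(\<lambda>x. (1 / (1 / J)) *\<^sub>R x + - ((1 / (1 / J)) *\<^sub>R - ((a + b) / 2 / J))) = (\<lambda>x. J * x + (a + b) / 2)"
      using J by (simp add: fun_eq_iff)
    moreover have "(\<lambda>x. J * x + (a + b) / 2) ` {-1..1} = {a..b}"
      using J by (subst image_affinity_atLeastAtMost) (auto simp: J_def field_simps)
    ultimately show ?thesis by (simp only: cbox_interval)
  qed
  ultimately show ?thesis
    unfolding J_def[symmetric] using J by (auto dest!: integral_unique simp: diff_divide_distrib)
qed

text \<open>The substitution is made in one coordinate at a time; the two half-widths multiply to
  \<open>Jdet\<close>.\<close>

lemma integral_to_ref:
  assumes g: "\<And>S. continuous_on S g"
    and k: "fst (el_lo G k) < fst (el_hi G k)" "snd (el_lo G k) < snd (el_hi G k)"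
  shows "integral (cbox (el_lo G k) (el_hi G k)) (\<lambda>x. g (to_ref G k x))
    = Jdet G k * integral (cbox (-1, -1) (1, 1)) g"
proof -
  obtain a1 a2 b1 b2 where ab: "el_lo G k = (a1, a2)" "el_hi G k = (b1, b2)" by (metis surj_pair)
  define T1 T2 where "T1 = (\<lambda>x. (x - (a1 + b1) / 2) / ((b1 - a1) / 2))"
    and "T2 = (\<lambda>x. (x - (a2 + b2) / 2) / ((b2 - a2) / 2))"
  have ref: "to_ref G k x = (T1 (fst x), T2 (snd x))" for x
    by (simp add: to_ref_def ab T1_def T2_def Jx_def Jy_def)
  have "continuous_on UNIV (\<lambda>x. g (to_ref G k x))"
    unfolding ref T1_def T2_def
    using k ab by (intro continuous_on_compose2[OF g[of UNIV]] continuous_intros) auto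
  from integral_prod_continuous[OF continuous_on_subset[OF this subset_UNIV], of a1 a2 b1 b2]
  have "integral (cbox (a1, a2) (b1, b2)) (\<lambda>x. g (to_ref G k x))
      = integral {a1..b1} (\<lambda>x. integral {a2..b2} (\<lambda>y. g (T1 x, T2 y)))"
    by (simp add: ref)
  also have "\<dots> = integral {a1..b1} (\<lambda>x. (b2 - a2) / 2 * integral {-1..1} (\<lambda>y. g (T1 x, y)))"
  proof -
    have "(\<lambda>y. g (x, y)) integrable_on {-1..1}" for x
      by (intro integrable_continuous_real continuous_on_compose2[OF g[of UNIV]] continuous_intros) auto
    then have "integral {a2..b2} (\<lambda>y. g (T1 x, T2 y))
        = (b2 - a2) / 2 * integral {-1..1} (\<lambda>y. g (T1 x, y))" for x
      unfolding T2_def using k ab by (intro integral_affine) simp_all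
    then show ?thesis by (simp only:)
  qed
  also have "\<dots> = (b2 - a2) / 2 * ((b1 - a1) / 2 * integral {-1..1} (\<lambda>x. integral {-1..1} (\<lambda>y. g (x, y))))"
  proof -
    have "(\<lambda>x. integral {-1..1} (\<lambda>y. g (x, y))) integrable_on {-1..1}"
      using integral_integrable_2dim[of "-1" "-1" 1 1 g, OF g] by simp
    then have "integral {a1..b1} (\<lambda>x. integral {-1..1} (\<lambda>y. g (T1 x, y)))
        = (b1 - a1) / 2 * integral {-1..1} (\<lambda>x. integral {-1..1} (\<lambda>y. g (x, y)))"
      unfolding T1_def using k ab by (intro integral_affine) simp_all
    then show ?thesis by simp
  qed
  also have "integral {-1..1} (\<lambda>x. integral {-1..1} (\<lambda>y. g (x, y))) = integral (cbox (-1, -1) (1, 1)) g"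
    using integral_prod_continuous[OF g, of "-1" "-1" 1 1] by simp
  finally show ?thesis by (simp add: ab Jdet_def Jx_def Jy_def)
qed

lemma broken_norm_sq_eq:
  assumes "cartesian_grid G" "\<And>k. k < num_elems G \<Longrightarrow> u k \<in> Q_space p"
  shows "broken_norm_sq G p c u = (\<Sum>k<num_elems G. Jdet G k * sobolev_ip p c (u k) (u k))"
  unfolding broken_norm_sq_def
proof (intro sum.cong refl)
  fix k assume "k \<in> {..<num_elems G}"
  then have k: "k < num_elems G" by simp
  note u = assms(2)[OF k]
  have "(\<lambda>x. let z = to_ref G k x in
       (u k z)\<^sup>2 + c / 2 * (((d_xi ^^ p) (u k) z)\<^sup>2 + ((d_eta ^^ p) (u k) z)\<^sup>2)
       + c\<^sup>2 / 4 * ((d_xi ^^ p) ((d_eta ^^ p) (u k)) z)\<^sup>2)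
     = (\<lambda>x. sobolev_density p c (u k) (u k) (to_ref G k x))"
    by (simp add: Let_def sobolev_density_def power2_eq_square)
  then show "integral (cbox (el_lo G k) (el_hi G k)) (\<lambda>x. let z = to_ref G k x in
       (u k z)\<^sup>2 + c / 2 * (((d_xi ^^ p) (u k) z)\<^sup>2 + ((d_eta ^^ p) (u k) z)\<^sup>2)
       + c\<^sup>2 / 4 * ((d_xi ^^ p) ((d_eta ^^ p) (u k)) z)\<^sup>2) = Jdet G k * sobolev_ip p c (u k) (u k)"
    using integral_to_ref[OF continuous_on_sobolev_density[OF u u], of G k c] assms(1) k
    by (simp add: sobolev_ip_def cartesian_grid_def)
qed

section \<open>Energy stability\<close>

theorem theorem4p4:
  fixes G :: grid and p :: nat and c \<beta> :: real and \<alpha> :: "real \<times> real"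
    and X :: "side \<Rightarrow> nat \<Rightarrow> real" and s_c s_v :: "nat \<times> side \<Rightarrow> real"
    and kind :: trace_kind and I :: "real set"
    and u :: "real \<Rightarrow> nat \<Rightarrow> real \<times> real \<Rightarrow> real" and uh :: "real \<Rightarrow> trace"
  assumes p: "p \<ge> 1"
    and beta: "\<beta> \<ge> 0"
    and grid: "cartesian_grid G"
    and flux_points: "flux_points p X"
    and I: "open I"
    and solution: "hfr_solution G p c \<alpha> \<beta> X (\<lambda>\<sigma>. s_c \<sigma> + s_v \<sigma>) kind I u uh"
    and transmission: "\<And>t. \<lbrakk>kind = EFR; c \<noteq> 0; t \<in> I\<rbrakk> \<Longrightarrow>
          pointwise_transmission G p c \<alpha> \<beta> X (\<lambda>\<sigma>. s_c \<sigma> + s_v \<sigma>) (u t) (uh t)"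
    and stab: "\<And>\<sigma>. \<sigma> \<in> sides G \<Longrightarrow> s_c \<sigma> + s_v \<sigma> > (\<alpha> \<bullet> normal (snd \<sigma>)) / 2"
    and c: "c \<ge> 0"
  shows "\<forall>t\<in>I. (\<lambda>\<tau>. broken_norm_sq G p c (u \<tau>)) differentiable (at t) \<and>
           1 / 2 * deriv (\<lambda>\<tau>. broken_norm_sq G p c (u \<tau>)) t \<le> 0"
proof
  fix t assume t: "t \<in> I"
  define st where "st = (\<lambda>\<sigma>. s_c \<sigma> + s_v \<sigma>)"
  note sol = bspec[OF solution[unfolded hfr_solution_def], folded st_def]
  note sol_u = sol[THEN conjunct1, rule_format]
    and sol_uh = sol[THEN conjunct2, THEN conjunct1]
    and sol_diff = sol[THEN conjunct2, THEN conjunct2, THEN conjunct1, rule_format]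
    and sol_scheme = sol[THEN conjunct2, THEN conjunct2, THEN conjunct2, THEN conjunct2, THEN conjunct1, rule_format]
    and sol_trans = sol[THEN conjunct2, THEN conjunct2, THEN conjunct2, THEN conjunct2, THEN conjunct2]
  note uQ = sol_u
  note uh = sol_uh[OF t] and discrete = sol_trans[OF t]
  \<comment> \<open>One predicate collects all properties of an element's time derivative, so that a
    single choice over the elements supplies them together.\<close>
  define time_deriv where "time_deriv k v' \<longleftrightarrow> v' \<in> Q_space p
      \<and> (\<forall>z\<in>cbox (-1, -1) (1, 1). deriv (\<lambda>\<tau>. u \<tau> k z) t = v' z)
      \<and> ((\<lambda>\<tau>. sobolev_ip p c (u \<tau> k) (u \<tau> k)) has_real_derivative 2 * sobolev_ip p c v' (u t k)) (at t)" for k v'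
  have "\<exists>v'. time_deriv k v'" if k: "k < num_elems G" for k
  proof (rule sobolev_ip_has_derivative[where v = "\<lambda>\<tau>. u \<tau> k" and c = c, OF I t flux_points uQ[OF _ k]])
    show "(\<lambda>\<tau>. u \<tau> k z) differentiable (at t)" if "z \<in> cbox (-1, -1) (1, 1)" for z
      by (rule sol_diff[OF t k that])
  qed (auto simp: time_deriv_def)
  then have "\<forall>k. \<exists>v'. k < num_elems G \<longrightarrow> time_deriv k v'" by blast
  from choice[OF this] obtain ut where "\<And>k. k < num_elems G \<Longrightarrow> time_deriv k (ut k)" by blast
  then have utQ: "\<And>k. k < num_elems G \<Longrightarrow> ut k \<in> Q_space p"
    and ut: "\<And>k z. k < num_elems G \<Longrightarrow> z \<in> cbox (-1, -1) (1, 1) \<Longrightarrow> deriv (\<lambda>\<tau>. u \<tau> k z) t = ut k z"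
    and D: "\<And>k. k < num_elems G \<Longrightarrow>
      ((\<lambda>\<tau>. sobolev_ip p c (u \<tau> k) (u \<tau> k)) has_real_derivative 2 * sobolev_ip p c (ut k) (u t k)) (at t)"
    by (simp_all add: time_deriv_def)
  define E where "E = (\<Sum>k<num_elems G. Jdet G k * sobolev_ip p c (ut k) (u t k))"
  have "((\<lambda>\<tau>. \<Sum>k<num_elems G. Jdet G k * sobolev_ip p c (u \<tau> k) (u \<tau> k)) has_real_derivative
      (\<Sum>k<num_elems G. Jdet G k * (2 * sobolev_ip p c (ut k) (u t k)))) (at t)"
    by (intro DERIV_sum DERIV_cmult D) simp
  also have "(\<Sum>k<num_elems G. Jdet G k * (2 * sobolev_ip p c (ut k) (u t k))) = 2 * E"
    by (simp add: E_def sum_distrib_left mult_ac)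
  finally have sum_deriv: "((\<lambda>\<tau>. \<Sum>k<num_elems G. Jdet G k * sobolev_ip p c (u \<tau> k) (u \<tau> k))
      has_real_derivative 2 * E) (at t)" .
  \<comment> \<open>The formula for the norm requires u in \<open>Q_space\<close>, known for times
    in I only.\<close>
  have "(\<Sum>k<num_elems G. Jdet G k * sobolev_ip p c (u \<tau> k) (u \<tau> k)) = broken_norm_sq G p c (u \<tau>)"
    if "\<tau> \<in> I" for \<tau>
    using broken_norm_sq_eq[where c = c and u = "u \<tau>", OF grid uQ[OF that]] by simp
  from has_field_derivative_transform_within_open[OF sum_deriv I t this]
  have deriv: "((\<lambda>\<tau>. broken_norm_sq G p c (u \<tau>)) has_real_derivative 2 * E) (at t)" .
  define B where "B = (\<lambda>\<sigma>. Jface G \<sigma> *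
     ((\<alpha> \<bullet> normal (snd \<sigma>)) / 2 * vcjh_ip p c (uh t (the_face G \<sigma>)) (uh t (the_face G \<sigma>))
      - vcjh_ip p c (\<lambda>s. common_flux G p c \<alpha> \<beta> X st (u t) (uh t) \<sigma> s \<bullet> normal (snd \<sigma>)) (uh t (the_face G \<sigma>))))"
  have "Jdet G k * sobolev_ip p c (ut k) (u t k) \<le> (\<Sum>f\<in>UNIV. B (k, f))" if k: "k < num_elems G" for k
    unfolding B_def snd_conv
  proof (rule element_energy[where G = G and k = k and u = "u t" and uh = "uh t" and stab = st and v' = "ut k",
        OF p c beta grid_J_pos[OF grid k] uQ[OF t k] _ flux_points _ utQ[OF k]])
    have side: "(k, f) \<in> sides G" for f using k by (simp add: sides_def)
    show "uh t (the_face G (k, f)) \<in> P_space p" for f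
      using trace_space_P_space[OF uh] side by (simp add: faces_def)
    show "\<alpha> \<bullet> normal f / 2 < st (k, f)" for f
      using stab[OF side] by (simp add: st_def)
    show "ut k z + 1 / Jdet G k * divg (flux_ref G p c \<alpha> \<beta> X (u t) (uh t) k) z
       + 1 / Jdet G k * (\<Sum>f\<in>UNIV. \<Sum>m\<in>{1..p + 1}. divg (corr p c X f m) z *
               flux_defect G p c \<alpha> \<beta> X st (u t) (uh t) (k, f) (X f m)) = 0"
      if z: "z \<in> cbox (-1, -1) (1, 1)" for z
      unfolding ut[OF k z, symmetric] by (rule sol_scheme[OF t k z])
  qed
  then have "E \<le> (\<Sum>k<num_elems G. \<Sum>f\<in>UNIV. B (k, f))"
    unfolding E_def by (intro sum_mono) simp
  \<comment> \<open>Summation over elements and their sides is what lets the bounds of neighbouring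
    elements meet on a face.\<close>
  also have "\<dots> = (\<Sum>\<sigma>\<in>sides G. B \<sigma>)"
    by (simp add: sides_def sum.cartesian_product)
  also have "\<dots> = 0"
    unfolding B_def
    using boundary_sum_eq_0[OF grid flux_points uQ[OF t] uh discrete] transmission[OF _ _ t]
    by (simp add: st_def)
  finally have "E \<le> 0" .
  then show "(\<lambda>\<tau>. broken_norm_sq G p c (u \<tau>)) differentiable (at t) \<and>
           1 / 2 * deriv (\<lambda>\<tau>. broken_norm_sq G p c (u \<tau>)) t \<le> 0"
    using deriv by (auto simp: DERIV_imp_deriv real_differentiable_def)
qed

end
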